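(* Let $M=M[P,Q]$ be a connected lattice path matroid of rank $r$ and nullity $m$. Let $F_1\subset F_2\subset\cdots\subset F_h$ be the fundamental flats of $M$ that are initial segments of $[m+r]$ and $G_1\subset G_2\subset\cdots\subset G_k$ the fundamental flats of $M$ that are final segments of $[m+r]$. Then the proper nontrivial connected flats of $M$ are exactly (i) $F_1,\ldots,F_h,G_1,\ldots,G_k$, and (ii) the intersections $F_i\cap G_j$ for which $m<\eta(F_i)+\eta(G_j)$. Moreover, a nontrivial connected flat of the form $F_i\cap G_j$ has rank $r(F_i)+r(G_j)-r$.
   Context: Lattice paths start at $(0,0)$ and use steps $E=(1,0)$ and $N=(0,1)$. For lattice paths $P,Q$ from $(0,0)$ to $(m,r)$ with $P$ never going above $Q$, let $\mathcal{P}$ be the set of lattice paths from $(0,0)$ to $(m,r)$ going neither above $Q$ nor below $P$, and for $1\le i\le r$ let $N_i=\{j:\text{step } j \text{ is the } i\text{-th North step of some path in }\mathcal{P}\}$. $M[P,Q]$ is the transversal matroid on $[m+r]$ with presentation $(N_1,\ldots,N_r)$. Initial segments are sets $[a]=\{1,\ldots,a\}$, final segments are sets $[b,m+r]=\{b,\ldots,m+r\}$. $\eta(X)=|X|-r(X)$. A flat $X$ is connected if $M|X$ is connected and nontrivial if dependent. A fundamental flat of a connected matroid $M$ is a connected flat $X$ with $|X|>1$, $r(X)<r(M)$, such that for some spanning circuit $C$ of $M$, $X\cap C$ is a basis of $M|X$. *)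

theory Defs
  imports Main
begin

section \<open>Finite matroids given by their independent sets\<close>

record 'a matroid =
  ground :: "'a set"
  indep :: "'a set \<Rightarrow> bool"

definition is_matroid :: "'a matroid \<Rightarrow> bool" where
  "is_matroid M \<longleftrightarrow>
     finite (ground M) \<and>
     (\<forall>I. indep M I \<longrightarrow> I \<subseteq> ground M) \<and>
     indep M {} \<and>
     (\<forall>I J. indep M J \<and> I \<subseteq> J \<longrightarrow> indep M I) \<and>
     (\<forall>I J. indep M I \<and> indep M J \<and> card I < card J \<longrightarrow> (\<exists>x\<in>J - I. indep M (insert x I)))"

definition rk :: "'a matroid \<Rightarrow> 'a set \<Rightarrow> nat" where
  "rk M X = Max {card I |I. I \<subseteq> X \<and> indep M I}"

text \<open>The subtraction does not truncate: for a subset \<open>X\<close> of the (finite) ground set of a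
  matroid, the rank of \<open>X\<close> is at most its cardinality.\<close>

definition nullity :: "'a matroid \<Rightarrow> 'a set \<Rightarrow> nat" where
  "nullity M X = card X - rk M X"

definition basis :: "'a matroid \<Rightarrow> 'a set \<Rightarrow> bool" where
  "basis M B \<longleftrightarrow> indep M B \<and> (\<forall>x\<in>ground M - B. \<not> indep M (insert x B))"

definition circuit :: "'a matroid \<Rightarrow> 'a set \<Rightarrow> bool" where
  "circuit M C \<longleftrightarrow> C \<subseteq> ground M \<and> \<not> indep M C \<and> (\<forall>D. D \<subset> C \<longrightarrow> indep M D)"

definition spanning :: "'a matroid \<Rightarrow> 'a set \<Rightarrow> bool" where
  "spanning M X \<longleftrightarrow> X \<subseteq> ground M \<and> rk M X = rk M (ground M)"

definition flat :: "'a matroid \<Rightarrow> 'a set \<Rightarrow> bool" where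
  "flat M X \<longleftrightarrow> X \<subseteq> ground M \<and> (\<forall>x\<in>ground M - X. rk M X < rk M (insert x X))"

definition restriction :: "'a matroid \<Rightarrow> 'a set \<Rightarrow> 'a matroid" where
  "restriction M X = \<lparr>ground = ground M \<inter> X, indep = (\<lambda>I. I \<subseteq> X \<and> indep M I)\<rparr>"

definition connected_matroid :: "'a matroid \<Rightarrow> bool" where
  "connected_matroid M \<longleftrightarrow>
     (\<forall>x\<in>ground M. \<forall>y\<in>ground M. x \<noteq> y \<longrightarrow> (\<exists>C. circuit M C \<and> x \<in> C \<and> y \<in> C))"

definition connected_flat :: "'a matroid \<Rightarrow> 'a set \<Rightarrow> bool" where
  "connected_flat M X \<longleftrightarrow> flat M X \<and> connected_matroid (restriction M X)"

definition nontrivial :: "'a matroid \<Rightarrow> 'a set \<Rightarrow> bool" where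
  "nontrivial M X \<longleftrightarrow> X \<subseteq> ground M \<and> \<not> indep M X"

definition fundamental_flat :: "'a matroid \<Rightarrow> 'a set \<Rightarrow> bool" where
  "fundamental_flat M X \<longleftrightarrow>
     connected_flat M X \<and> 1 < card X \<and> rk M X < rk M (ground M) \<and>
     (\<exists>C. circuit M C \<and> spanning M C \<and> basis (restriction M X) (X \<inter> C))"


section \<open>Transversal matroids\<close>

text \<open>The matroid on \<open>S\<close> with presentation \<open>(A 1, \<dots>, A r)\<close>: the independent sets are the
  partial transversals of this set system.\<close>

definition transversal_matroid :: "'a set \<Rightarrow> nat \<Rightarrow> (nat \<Rightarrow> 'a set) \<Rightarrow> 'a matroid" where
  "transversal_matroid S r A =
     \<lparr>ground = S,
      indep = (\<lambda>I. I \<subseteq> S \<and> (\<exists>f. inj_on f I \<and> (\<forall>x\<in>I. f x \<in> {1..r} \<and> x \<in> A (f x))))\<rparr>"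

lemma is_matroid_transversal_matroid:
  assumes "finite S"
  shows "is_matroid (transversal_matroid S r A)"
proof -
  define m where "m = (\<lambda>f I. inj_on f I \<and> (\<forall>x\<in>I. f x \<in> {1..r} \<and> x \<in> A (f x)))"
  define ind where "ind = (\<lambda>I. I \<subseteq> S \<and> (\<exists>f. m f I))"
  have "\<exists>x\<in>J - I. ind (insert x I)" if I: "ind I" and J: "ind J" and less: "card I < card J" for I J
  proof -
    have fin: "finite I" "finite J"
      using I J assms by (auto simp: ind_def intro: finite_subset)
    obtain g where g: "m g J"
      using J by (auto simp: ind_def)
    define agree where "agree = (\<lambda>f. card {x \<in> I \<inter> J. f x = g x})"
    have bound: "agree f \<le> card I" for f
      unfolding agree_def using fin by (intro card_mono) auto
    obtain f0 where "m f0 I"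
      using I by (auto simp: ind_def)
    then have "\<exists>f. m f I \<and> (\<forall>f'. m f' I \<longrightarrow> agree f' \<le> agree f)"
      using bound
      by (intro ex_has_greatest_nat[of "\<lambda>f. m f I" f0 agree "Suc (card I)"])
        (auto simp: less_Suc_eq_le)
    then obtain f where f: "m f I" and max: "\<And>f'. m f' I \<Longrightarrow> agree f' \<le> agree f"
      by (elim exE conjE) simp
    have "card (f ` I) < card (g ` J)"
      using f g less by (simp add: m_def card_image)
    then have "\<not> g ` J \<subseteq> f ` I"
      using card_mono[of "f ` I" "g ` J"] fin(1) by (metis finite_imageI not_le)
    then obtain y where y: "y \<in> J" "g y \<notin> f ` I"
      by blast
    define f' where "f' = f(y := g y)"
    have "inj_on f' I"
      unfolding f'_def using f y by (intro inj_on_fun_updI) (auto simp: m_def)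
    moreover have "f' y \<notin> f' ` (I - {y})"
      using y by (auto simp: f'_def)
    ultimately have "inj_on f' (insert y I)"
      by simp
    moreover have "f' x \<in> {1..r} \<and> x \<in> A (f' x)" if "x \<in> insert y I" for x
      using that f g y(1) by (cases "x = y") (simp_all add: m_def f'_def)
    ultimately have m': "m f' (insert y I)"
      by (simp add: m_def)
    have "y \<notin> I"
    proof
      assume "y \<in> I"
      then have "f y \<noteq> g y"
        using y(2) by (metis imageI)
      then have "{x \<in> I \<inter> J. f x = g x} \<subseteq> {x \<in> I \<inter> J. f' x = g x}"
        and "y \<in> {x \<in> I \<inter> J. f' x = g x} - {x \<in> I \<inter> J. f x = g x}"
        using \<open>y \<in> I\<close> y(1) by (auto simp: f'_def)
      then have "{x \<in> I \<inter> J. f x = g x} \<subset> {x \<in> I \<inter> J. f' x = g x}"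
        by blast
      then have "agree f < agree f'"
        unfolding agree_def using fin by (intro psubset_card_mono) auto
      then show False
        using max[of f'] m' \<open>y \<in> I\<close> by (simp add: insert_absorb)
    qed
    then show ?thesis
      using y I J m' by (auto simp: ind_def)
  qed
  then have augment: "\<forall>I J. ind I \<and> ind J \<and> card I < card J \<longrightarrow> (\<exists>x\<in>J - I. ind (insert x I))"
    by blast
  have hereditary: "\<forall>I J. ind J \<and> I \<subseteq> J \<longrightarrow> ind I"
    unfolding ind_def m_def by (meson inj_on_subset order_trans subsetD)
  have empty: "ind {}"
    by (simp add: ind_def m_def)
  have subset: "\<forall>I. ind I \<longrightarrow> I \<subseteq> S"
    by (simp add: ind_def)
  have "transversal_matroid S r A = \<lparr>ground = S, indep = ind\<rparr>"
    by (simp add: transversal_matroid_def ind_def m_def)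
  then show ?thesis
    using assms augment hereditary empty subset by (simp add: is_matroid_def)
qed


section \<open>Lattice path matroids\<close>

datatype step = East | North

text \<open>A lattice path starting at \<open>(0, 0)\<close> is represented by its list of steps.\<close>

definition lattice_paths :: "nat \<Rightarrow> nat \<Rightarrow> step list set" where
  "lattice_paths m r = {R. count_list R East = m \<and> count_list R North = r}"

text \<open>After \<open>k\<close> steps every path is on the antidiagonal \<open>x + y = k\<close>, so two paths with the same
  endpoints are compared by their heights after the same number of steps.\<close>

definition never_above :: "step list \<Rightarrow> step list \<Rightarrow> bool" where
  "never_above P Q \<longleftrightarrow> (\<forall>k. count_list (take k P) North \<le> count_list (take k Q) North)"

definition paths_between :: "nat \<Rightarrow> nat \<Rightarrow> step list \<Rightarrow> step list \<Rightarrow> step list set" where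
  "paths_between m r P Q = {R \<in> lattice_paths m r. never_above P R \<and> never_above R Q}"

text \<open>Steps are numbered from 1, so step \<open>j\<close> of \<open>R\<close> is \<open>R ! (j - 1)\<close>.\<close>

definition is_ith_North :: "step list \<Rightarrow> nat \<Rightarrow> nat \<Rightarrow> bool" where
  "is_ith_North R i j \<longleftrightarrow>
     j \<in> {1..length R} \<and> R ! (j - 1) = North \<and> count_list (take j R) North = i"

definition North_set :: "nat \<Rightarrow> nat \<Rightarrow> step list \<Rightarrow> step list \<Rightarrow> nat \<Rightarrow> nat set" where
  "North_set m r P Q i = {j. \<exists>R\<in>paths_between m r P Q. is_ith_North R i j}"

definition lattice_path_matroid :: "nat \<Rightarrow> nat \<Rightarrow> step list \<Rightarrow> step list \<Rightarrow> nat matroid" where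
  "lattice_path_matroid m r P Q = transversal_matroid {1..m + r} r (North_set m r P Q)"

definition initial_segment :: "nat set \<Rightarrow> bool" where
  "initial_segment X \<longleftrightarrow> (\<exists>a. X = {1..a})"

definition final_segment :: "nat \<Rightarrow> nat set \<Rightarrow> bool" where
  "final_segment n X \<longleftrightarrow> (\<exists>b\<ge>1. X = {b..n})"

end

theory Submission
  imports Defs
begin

text \<open>
  Let \<open>p k\<close> and \<open>q k\<close> be the heights of \<open>P\<close> and \<open>Q\<close> after \<open>k\<close> steps. A set \<open>I\<close> is independent in
  \<open>M[P,Q]\<close> iff \<open>|I \<inter> (s,t]| \<le> q t - p s\<close> for all \<open>s \<le> t\<close>, so a circuit \<open>C\<close> with least element
  \<open>a + 1\<close> and greatest element \<open>b\<close> has \<open>q b - p a + 1\<close> elements. If \<open>C\<close> contains the least and the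
  greatest element of a connected flat \<open>X\<close> and \<open>z\<close> is a missing element between them, then adjoining
  \<open>z\<close> to a proper subset of \<open>C\<close> preserves independence, which contradicts this count; hence \<open>X\<close>
  is an interval \<open>(a,b]\<close>. An interval with \<open>b - a > q b - p a\<close> is a connected flat iff \<open>P\<close> has a corner
  North-East at \<open>a\<close> (or \<open>a = 0\<close>) and \<open>Q\<close> has a corner East-North at \<open>b\<close> (or \<open>b\<close> is the last
  element). These conditions on \<open>a\<close> and \<open>b\<close> are independent of each other. When \<open>a = 0\<close>, the
  spanning circuit that shows \<open>(0,b]\<close> to be fundamental consists of the North steps of \<open>Q\<close> and the
  last element; dually, for final segments, of the North steps of \<open>P\<close> and \<open>1\<close>.
\<close>

section \<open>Finite matroids\<close>

lemma finite_ground: "is_matroid M \<Longrightarrow> finite (ground M)"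
  by (simp add: is_matroid_def)

lemma indep_ground: "is_matroid M \<Longrightarrow> indep M I \<Longrightarrow> I \<subseteq> ground M"
  by (simp add: is_matroid_def)

lemma indep_empty: "is_matroid M \<Longrightarrow> indep M {}"
  by (simp add: is_matroid_def)

lemma indep_subset:
  assumes "is_matroid M" "indep M J" "I \<subseteq> J"
  shows "indep M I"
proof -
  have "\<forall>I J. indep M J \<and> I \<subseteq> J \<longrightarrow> indep M I"
    using assms(1) unfolding is_matroid_def by (elim conjE)
  then show ?thesis
    using assms(2,3) by blast
qed

lemma indep_finite: "is_matroid M \<Longrightarrow> indep M I \<Longrightarrow> finite I"
  using finite_subset[OF indep_ground finite_ground] .

lemma augment:
  assumes "is_matroid M" "indep M I" "indep M J" "card I < card J"
  obtains x where "x \<in> J - I" "indep M (insert x I)"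
proof -
  have "\<forall>I J. indep M I \<and> indep M J \<and> card I < card J \<longrightarrow> (\<exists>x\<in>J - I. indep M (insert x I))"
    using assms(1) unfolding is_matroid_def by (elim conjE)
  then show ?thesis
    using assms(2-4) that by blast
qed

lemma finite_indep_cards:
  assumes "is_matroid M"
  shows "finite {card I |I. I \<subseteq> X \<and> indep M I}"
proof (rule finite_subset)
  show "{card I |I. I \<subseteq> X \<and> indep M I} \<subseteq> card ` Pow (ground M)"
    using indep_ground[OF assms] by blast
  show "finite (card ` Pow (ground M))"
    using finite_ground[OF assms] by simp
qed

lemma card_le_rk:
  assumes "is_matroid M" "indep M I" "I \<subseteq> X"
  shows "card I \<le> rk M X"
  unfolding rk_def using assms by (intro Max_ge finite_indep_cards) auto

lemma rk_attained:
  assumes "is_matroid M"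
  obtains I where "I \<subseteq> X" "indep M I" "card I = rk M X"
proof -
  have "{card I |I. I \<subseteq> X \<and> indep M I} \<noteq> {}"
    using indep_empty[OF assms] by blast
  then have "rk M X \<in> {card I |I. I \<subseteq> X \<and> indep M I}"
    unfolding rk_def using assms by (intro Max_in finite_indep_cards)
  then show ?thesis
    using that by auto
qed

lemma indep_extend:
  assumes M: "is_matroid M" and "indep M I" "I \<subseteq> X"
  obtains B where "I \<subseteq> B" "B \<subseteq> X" "indep M B" "card B = rk M X"
  using assms(2,3)
proof (induction "rk M X - card I" arbitrary: I thesis)
  case 0
  then show ?case
    using card_le_rk[OF M] by (metis diff_is_0_eq le_antisym order_refl)
next
  case (Suc d)
  obtain J where J: "J \<subseteq> X" "indep M J" "card J = rk M X"
    using rk_attained[OF M] .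
  with Suc obtain x where x: "x \<in> J - I" "indep M (insert x I)"
    using augment[OF M, of I J] by (metis zero_less_Suc zero_less_diff)
  have "card (insert x I) = Suc (card I)"
    using x(1) indep_finite[OF M \<open>indep M I\<close>] by simp
  then have "d = rk M X - card (insert x I)"
    using Suc.hyps(2) by linarith
  moreover have "insert x I \<subseteq> X"
    using Suc.prems(3) x(1) J(1) by blast
  ultimately obtain B where "insert x I \<subseteq> B" "B \<subseteq> X" "indep M B" "card B = rk M X"
    using Suc.hyps(1)[of "insert x I"] x(2) by metis
  then show ?case
    using Suc.prems(1)[of B] by blast
qed

text \<open>Extend \<open>I\<close> to a basis \<open>B\<close> of \<open>X\<close>. Adding
  \<open>z\<close> raises the rank, so \<open>B\<close> can be augmented inside
  \<open>insert z X\<close>, and only by \<open>z\<close>, because \<open>B\<close> is already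
  maximal in \<open>X\<close>.\<close>

lemma flat_indep_insert:
  assumes M: "is_matroid M" and "flat M X" "z \<in> ground M - X" "indep M I" "I \<subseteq> X"
  shows "indep M (insert z I)"
proof -
  obtain B where B: "I \<subseteq> B" "B \<subseteq> X" "indep M B" "card B = rk M X"
    using indep_extend assms(1,4,5) .
  obtain J where J: "J \<subseteq> insert z X" "indep M J" "card J = rk M (insert z X)"
    using rk_attained[OF M] .
  have "card B < card J"
    using assms(2,3) B(4) J(3) by (simp add: flat_def)
  then obtain x where x: "x \<in> J - B" "indep M (insert x B)"
    using augment M B(3) J(2) by blast
  have "x = z"
  proof (rule ccontr)
    assume "x \<noteq> z"
    then have "card (insert x B) \<le> rk M X"
      using x J(1) B(2) by (intro card_le_rk[OF M]) auto
    then show False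
      using x(1) B(4) indep_finite[OF M B(3)] by simp
  qed
  then show ?thesis
    using indep_subset[OF M x(2)] B(1) by blast
qed

lemma dependent_contains_circuit:
  assumes M: "is_matroid M" and "X \<subseteq> ground M" "\<not> indep M X"
  obtains C where "C \<subseteq> X" "circuit M C"
proof -
  have "finite X"
    using assms(2) finite_ground[OF M] by (rule finite_subset)
  then have "\<exists>C\<subseteq>X. circuit M C"
    using assms(2,3)
  proof (induction X rule: finite_psubset_induct)
    case (psubset X)
    show ?case
    proof (cases "circuit M X")
      case False
      then obtain D where "D \<subset> X" "\<not> indep M D"
        using psubset.prems unfolding circuit_def by blast
      then show ?thesis
        using psubset.IH[of D] psubset.prems by blast
    qed blast
  qed
  then show ?thesis
    using that by blast
qed

lemma circuit_restriction: "circuit (restriction M X) C \<longleftrightarrow> C \<subseteq> X \<and> circuit M C"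
  unfolding circuit_def restriction_def by auto

lemma connected_restriction_circuit:
  assumes "connected_matroid (restriction M X)" "X \<subseteq> ground M" "x \<in> X" "y \<in> X" "x \<noteq> y"
  obtains C where "C \<subseteq> X" "circuit M C" "x \<in> C" "y \<in> C"
proof -
  have "x \<in> ground (restriction M X)" "y \<in> ground (restriction M X)"
    using assms by (auto simp: restriction_def)
  then obtain C where "circuit (restriction M X) C" "x \<in> C" "y \<in> C"
    using assms(1,5) unfolding connected_matroid_def by blast
  then show ?thesis
    using that[of C] by (simp add: circuit_restriction)
qed


section \<open>Functions increasing by unit steps\<close>

definition unit_steps :: "(nat \<Rightarrow> nat) \<Rightarrow> bool" where
  "unit_steps c \<longleftrightarrow> (\<forall>k. c k \<le> c (Suc k) \<and> c (Suc k) \<le> Suc (c k))"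

text \<open>The positions of the North steps. Since \<open>0 - 1 = 0\<close>, position 0 never
  counts.\<close>

definition rises :: "(nat \<Rightarrow> nat) \<Rightarrow> nat set" where
  "rises c = {i. c (i - 1) < c i}"

lemma unit_steps_mono: "unit_steps c \<Longrightarrow> s \<le> t \<Longrightarrow> c s \<le> c t"
  unfolding unit_steps_def by (simp add: lift_Suc_mono_le)

lemma unit_steps_lipschitz:
  assumes "unit_steps c" "s \<le> t"
  shows "c t + s \<le> c s + t"
  using assms(2)
proof (induction t rule: dec_induct)
  case (step t)
  moreover have "c (Suc t) \<le> Suc (c t)"
    using assms(1) unfolding unit_steps_def by blast
  ultimately show ?case
    by simp
qed simp

lemma unit_steps_max:
  assumes "unit_steps c" "unit_steps d"
  shows "unit_steps (\<lambda>k. max (c k) (d k))"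
  unfolding unit_steps_def
proof
  fix k
  have "c k \<le> c (Suc k) \<and> c (Suc k) \<le> Suc (c k)" "d k \<le> d (Suc k) \<and> d (Suc k) \<le> Suc (d k)"
    using assms unfolding unit_steps_def by blast+
  then show "max (c k) (d k) \<le> max (c (Suc k)) (d (Suc k)) \<and>
      max (c (Suc k)) (d (Suc k)) \<le> Suc (max (c k) (d k))"
    by linarith
qed

lemma unit_steps_min:
  assumes "unit_steps c" "unit_steps d"
  shows "unit_steps (\<lambda>k. min (c k) (d k))"
  unfolding unit_steps_def
proof
  fix k
  have "c k \<le> c (Suc k) \<and> c (Suc k) \<le> Suc (c k)" "d k \<le> d (Suc k) \<and> d (Suc k) \<le> Suc (d k)"
    using assms unfolding unit_steps_def by blast+
  then show "min (c k) (d k) \<le> min (c (Suc k)) (d (Suc k)) \<and>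
      min (c (Suc k)) (d (Suc k)) \<le> Suc (min (c k) (d k))"
    by linarith
qed

text \<open>Slope-one lines, cut off at height 0; new paths are glued from them by
  \<open>min\<close> and \<open>max\<close>.\<close>

lemma unit_steps_line: "unit_steps (\<lambda>k. c + k - d)"
  unfolding unit_steps_def by auto

lemma card_rises:
  assumes "unit_steps c" "s \<le> t"
  shows "c s + card (rises c \<inter> {s<..t}) = c t"
  using assms(2)
proof (induction t rule: dec_induct)
  case (step t)
  have c: "c (Suc t) = c t \<or> c (Suc t) = Suc (c t)"
    using assms(1) unfolding unit_steps_def by (metis le_SucE le_antisym)
  have "rises c \<inter> {s<..Suc t} =
      (if c t < c (Suc t) then insert (Suc t) (rises c \<inter> {s<..t}) else rises c \<inter> {s<..t})"
    using step(1) by (auto simp: rises_def le_Suc_eq)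
  then show ?case
    using c step by auto
qed simp


section \<open>Independence between two paths\<close>

text \<open>The numbers \<open>p k\<close> and \<open>q k\<close> are the heights of the lower and of the upper path after
  \<open>k\<close> steps.\<close>

locale bounded_paths =
  fixes n r :: nat and p q :: "nat \<Rightarrow> nat" and M :: "nat matroid"
  assumes unit_p: "unit_steps p" and unit_q: "unit_steps q"
    and p_le_q: "p k \<le> q k"
    and q_0: "q 0 = 0" and p_n: "p n = r" and q_n: "q n = r"
    and matroid: "is_matroid M"
    and ground: "ground M = {1..n}"
    and indep_iff: "indep M I \<longleftrightarrow>
      I \<subseteq> {1..n} \<and> (\<forall>s t. s \<le> t \<longrightarrow> p s + card (I \<inter> {s<..t}) \<le> q t)"
begin

lemmas p_mono = unit_steps_mono[OF unit_p]
lemmas q_mono = unit_steps_mono[OF unit_q]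
lemmas p_lipschitz = unit_steps_lipschitz[OF unit_p]
lemmas q_lipschitz = unit_steps_lipschitz[OF unit_q]

lemma p_0: "p 0 = 0"
  using p_le_q[of 0] q_0 by simp

lemma indep_card:
  assumes "indep M I" "I \<subseteq> {a<..b}" "a \<le> b"
  shows "p a + card I \<le> q b"
  using assms unfolding indep_iff by (metis Int_absorb2)

text \<open>The counting function of \<open>I\<close>, started at height \<open>d\<close>, is a path
  between the bounds, and the count on a window is a difference of two of its heights.\<close>

lemma indep_between:
  assumes I: "I \<subseteq> {a<..b}" and "b \<le> n"
    and between: "\<And>k. a \<le> k \<Longrightarrow> k \<le> b \<Longrightarrow>
      p k \<le> d + card (I \<inter> {a<..k}) \<and> d + card (I \<inter> {a<..k}) \<le> q k"
  shows "indep M I"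
  unfolding indep_iff
proof (intro conjI allI impI)
  show "I \<subseteq> {1..n}"
    using I \<open>b \<le> n\<close> by force
  fix s t :: nat
  assume "s \<le> t"
  \<comment> \<open>This loses no element of \<open>I\<close> and only tightens the bound, as
    \<open>p s \<le> p s'\<close> and \<open>q t' \<le> q t\<close>. If \<open>s' > t'\<close>,
    nothing is counted.\<close>
  define s' t' where "s' = max s a" and "t' = min t b"
  have eq: "I \<inter> {s<..t} = I \<inter> {s'<..t'}"
    using I by (auto simp: s'_def t'_def)
  show "p s + card (I \<inter> {s<..t}) \<le> q t"
  proof (cases "s' \<le> t'")
    case True
    then have "I \<inter> {a<..t'} = (I \<inter> {a<..s'}) \<union> (I \<inter> {s'<..t'})"
      by (auto simp: s'_def)
    moreover have "(I \<inter> {a<..s'}) \<inter> (I \<inter> {s'<..t'}) = {}"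
      by auto
    ultimately have "card (I \<inter> {a<..t'}) = card (I \<inter> {a<..s'}) + card (I \<inter> {s'<..t'})"
      by (simp add: card_Un_disjoint)
    moreover have "p s' \<le> d + card (I \<inter> {a<..s'})" "d + card (I \<inter> {a<..t'}) \<le> q t'"
      using between[of s'] between[of t'] True by (auto simp: s'_def t'_def)
    moreover have "p s \<le> p s'" "q t' \<le> q t"
      by (auto simp: s'_def t'_def intro: p_mono q_mono)
    ultimately show ?thesis
      unfolding eq by linarith
  next
    case False
    then show ?thesis
      unfolding eq using p_mono[OF \<open>s \<le> t\<close>] p_le_q[of t] by simp
  qed
qed

lemma indep_rises:
  assumes "unit_steps c" "a \<le> b" "b \<le> n"
    and "\<And>k. a \<le> k \<Longrightarrow> k \<le> b \<Longrightarrow> p k \<le> c k \<and> c k \<le> q k"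
  shows "indep M (rises c \<inter> {a<..b})"
proof (rule indep_between[where d = "c a"])
  fix k
  assume k: "a \<le> k" "k \<le> b"
  then have "rises c \<inter> {a<..b} \<inter> {a<..k} = rises c \<inter> {a<..k}"
    by auto
  then have "c a + card (rises c \<inter> {a<..b} \<inter> {a<..k}) = c k"
    using card_rises[OF assms(1) k(1)] by simp
  then show "p k \<le> c a + card (rises c \<inter> {a<..b} \<inter> {a<..k}) \<and>
      c a + card (rises c \<inter> {a<..b} \<inter> {a<..k}) \<le> q k"
    using assms(4)[OF k] by simp
qed (use assms in auto)

section \<open>Rank and dependence of intervals\<close>

lemma interval_basis:
  assumes "a \<le> b" "b \<le> n" "q b + a \<le> p a + b"
  obtains B where "B \<subseteq> {a<..b}" "indep M B" "p a + card B = q b"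
proof -
  \<comment> \<open>The path climbs with slope one from height \<open>p a\<close> until it meets
    \<open>q\<close> and then follows \<open>q\<close>. The third assumption says that they have met
    by \<open>b\<close>.\<close>
  define c where "c = (\<lambda>k. min (q k) (p a + k - a))"
  have c: "unit_steps c"
    unfolding c_def by (intro unit_steps_min unit_steps_line unit_q)
  have "c a = p a" "c b = q b"
    using assms p_le_q[of a] by (auto simp: c_def)
  then have "p a + card (rises c \<inter> {a<..b}) = q b"
    using card_rises[OF c assms(1)] by simp
  moreover have "indep M (rises c \<inter> {a<..b})"
  proof (intro indep_rises c assms)
    fix k
    assume k: "a \<le> k" "k \<le> b"
    then show "p k \<le> c k \<and> c k \<le> q k"
      using p_lipschitz[OF k(1)] p_le_q[of k] by (auto simp: c_def)
  qed
  ultimately show ?thesis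
    using that by blast
qed

lemma rk_interval:
  assumes "a \<le> b" "b \<le> n" "q b + a \<le> p a + b"
  shows "rk M {a<..b} + p a = q b"
proof -
  obtain B where B: "B \<subseteq> {a<..b}" "indep M B" "p a + card B = q b"
    using interval_basis[OF assms] .
  obtain I where I: "I \<subseteq> {a<..b}" "indep M I" "card I = rk M {a<..b}"
    using rk_attained[OF matroid] .
  show ?thesis
    using indep_card[OF I(2,1) assms(1)] I(3) card_le_rk[OF matroid B(2,1)] B(3) by linarith
qed

lemma rk_le_interval:
  assumes "X \<subseteq> {a<..b}" "a \<le> b"
  shows "rk M X + p a \<le> q b"
proof -
  obtain I where I: "I \<subseteq> X" "indep M I" "card I = rk M X"
    using rk_attained[OF matroid] .
  then show ?thesis
    using indep_card[OF I(2), of a b] assms by (simp add: subset_trans add.commute)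
qed

lemma rk_ground: "rk M (ground M) = r"
proof -
  have "{0<..n} = ground M"
    unfolding ground by (simp add: atLeastSucAtMost_greaterThanAtMost)
  moreover have "r \<le> n"
    using p_lipschitz[of 0 n] p_0 p_n by simp
  ultimately show ?thesis
    using rk_interval[of 0 n] p_0 q_n by simp
qed

lemma dependent_interval:
  assumes "a \<le> b" "b \<le> n"
  shows "indep M {a<..b} \<longleftrightarrow> p a + b \<le> q b + a"
proof
  assume "indep M {a<..b}"
  then show "p a + b \<le> q b + a"
    using indep_card[of "{a<..b}" a b] assms(1) by simp
next
  \<comment> \<open>The whole interval is the set of North steps of the slope-one line from height
    \<open>p a\<close> at \<open>a\<close>. The unit steps of \<open>p\<close> keep it above
    \<open>p\<close>; \<open>le\<close> and the unit steps of \<open>q\<close>, traced back from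
    \<open>b\<close>, keep it below \<open>q\<close>.\<close>
  assume le: "p a + b \<le> q b + a"
  show "indep M {a<..b}"
  proof (rule indep_between[where d = "p a"])
    fix k
    assume k: "a \<le> k" "k \<le> b"
    then have "{a<..b} \<inter> {a<..k} = {a<..k}"
      by auto
    then show "p k \<le> p a + card ({a<..b} \<inter> {a<..k}) \<and>
        p a + card ({a<..b} \<inter> {a<..k}) \<le> q k"
      using k le p_lipschitz[OF k(1)] q_lipschitz[OF k(2)] by (simp; linarith)
  qed (use assms in auto)
qed

text \<open>Some inequality for a window \<open>(s,t]\<close> fails on \<open>C\<close>. By
  minimality the window contains \<open>C\<close>, and shrinking it to \<open>(x - 1,y]\<close>
  keeps the failure; this bounds \<open>card C\<close> from below. The independent set
  \<open>C - {x}\<close> bounds it from above.\<close>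

lemma circuit_card:
  assumes C: "circuit M C" and x: "x \<in> C" and y: "y \<in> C" and sub: "C \<subseteq> {x..y}"
  shows "p (x - 1) + card C = Suc (q y)"
proof -
  have ind: "indep M D" if "D \<subset> C" for D
    using C that unfolding circuit_def by blast
  have "C \<subseteq> {1..n}" "\<not> indep M C"
    using C ground unfolding circuit_def by auto
  then obtain s t where st: "s \<le> t" "q t < p s + card (C \<inter> {s<..t})"
    unfolding indep_iff by (meson not_le)
  have "C \<subseteq> {s<..t}"
  proof (rule ccontr)
    assume "\<not> C \<subseteq> {s<..t}"
    then have "indep M (C \<inter> {s<..t})"
      by (intro ind) blast
    then show False
      using indep_card[of "C \<inter> {s<..t}" s t] st by auto
  qed
  then have "s < x" "y \<le> t"
    using x y by auto
  then have "p s \<le> p (x - 1)" "q y \<le> q t"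
    by (auto intro: p_mono q_mono)
  moreover have "C \<inter> {s<..t} = C"
    using \<open>C \<subseteq> {s<..t}\<close> by blast
  moreover have "p (x - 1) + card (C - {x}) \<le> q y"
  proof (rule indep_card)
    show "indep M (C - {x})"
      using x by (intro ind) blast
    show "C - {x} \<subseteq> {x - 1<..y}" "x - 1 \<le> y"
      using sub y by force+
  qed
  moreover have "card C = Suc (card (C - {x}))"
    using x \<open>C \<subseteq> {s<..t}\<close> by (intro card.remove) (auto intro: finite_subset)
  ultimately show ?thesis
    using st(2) by simp
qed

end


section \<open>Connected flats\<close>

text \<open>On a single element connectedness is vacuous, and that element may be a loop or a
  coloop; \<open>2 \<le> n\<close> excludes this.\<close>

locale connected_paths = bounded_paths +
  assumes connected: "connected_matroid M" and n_ge_2: "2 \<le> n"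
begin

section \<open>Strict separation of the two paths\<close>

text \<open>Cut a circuit through \<open>k\<close> and \<open>Suc k\<close> between these elements.
  Both pieces are independent, so they have at most \<open>q k - p (x - 1)\<close> and
  \<open>q y - p k\<close> elements; the total is known from \<open>circuit_card\<close>.\<close>

lemma p_less_q:
  assumes "0 < k" "k < n"
  shows "p k < q k"
proof -
  have "k \<in> ground M" "Suc k \<in> ground M"
    using assms by (simp_all add: ground)
  then obtain C where C: "circuit M C" "k \<in> C" "Suc k \<in> C"
    using connected unfolding connected_matroid_def by (metis n_not_Suc_n)
  have sub: "C \<subseteq> {1..n}"
    using C(1) unfolding circuit_def ground by blast
  then have fin: "finite C"
    by (rule finite_subset) simp
  define x y where "x = Min C" and "y = Max C"
  have "C \<noteq> {}"
    using C(2) by blast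
  then have xy: "x \<in> C" "y \<in> C" "C \<subseteq> {x..y}"
    using fin by (auto simp: x_def y_def)
  then have "1 \<le> x" "x \<le> k" "Suc k \<le> y"
    using C(2,3) sub by auto
  have ind: "indep M D" if "D \<subset> C" for D
    using C(1) that unfolding circuit_def by blast
  have "p (x - 1) + card (C \<inter> {..k}) \<le> q k"
  proof (rule indep_card)
    show "indep M (C \<inter> {..k})"
    proof (rule ind)
      have "Suc k \<notin> C \<inter> {..k}"
        by simp
      then show "C \<inter> {..k} \<subset> C"
        using C(3) by blast
    qed
    show "C \<inter> {..k} \<subseteq> {x - 1<..k}" "x - 1 \<le> k"
      using xy(3) \<open>1 \<le> x\<close> \<open>x \<le> k\<close> by fastforce+
  qed
  moreover have "p k + card (C \<inter> {k<..}) \<le> q y"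
  proof (rule indep_card)
    show "indep M (C \<inter> {k<..})"
    proof (rule ind)
      have "k \<notin> C \<inter> {k<..}"
        by simp
      then show "C \<inter> {k<..} \<subset> C"
        using C(2) by blast
    qed
    show "C \<inter> {k<..} \<subseteq> {k<..y}" "k \<le> y"
      using xy(3) \<open>Suc k \<le> y\<close> by auto
  qed
  moreover have "card C = card (C \<inter> {..k}) + card (C \<inter> {k<..})"
  proof -
    have "C = (C \<inter> {..k}) \<union> (C \<inter> {k<..})"
      by auto
    moreover have "(C \<inter> {..k}) \<inter> (C \<inter> {k<..}) = {}"
      by auto
    ultimately show ?thesis
      using fin by (metis card_Un_disjoint finite_Int)
  qed
  moreover have "p (x - 1) + card C = Suc (q y)"
    using circuit_card C(1) xy by blast
  ultimately show ?thesis
    by linarith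
qed

lemma p_pred_less_q:
  assumes "0 < k" "k \<le> n"
  shows "p (k - 1) < q k"
proof (cases "k = n")
  case True
  then show ?thesis
    using p_less_q[of "n - 1"] q_mono[of "n - 1" n] n_ge_2 by simp
next
  case False
  then show ?thesis
    using p_less_q[of k] p_mono[of "k - 1" k] assms by simp
qed

text \<open>\<open>P\<close> must start with East, being strictly below \<open>Q\<close> after one
  step; dually \<open>Q\<close> ends with East. Hence \<open>a = 0\<close> and \<open>b = n\<close>
  meet the conditions on East steps imposed below.\<close>

lemma p_1: "p 1 = 0"
  using p_less_q[of 1] q_lipschitz[of 0 1] q_0 n_ge_2 by simp

lemma q_pred_n: "q (n - 1) = r"
proof -
  have "p n + (n - 1) \<le> p (n - 1) + n"
    by (rule p_lipschitz) simp
  then show ?thesis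
    using p_less_q[of "n - 1"] q_mono[of "n - 1" n] n_ge_2 p_n q_n by simp
qed

text \<open>For \<open>x < y\<close> the lowest path \<open>R\<close> from \<open>(a, p a)\<close> to \<open>(b, q b)\<close> that stays strictly above
  the lower bound between \<open>x\<close> and \<open>y\<close> has a North step at \<open>x\<close> and an East step at \<open>y\<close>.
  These two steps can be exchanged, so \<open>x\<close> lies on the fundamental circuit of \<open>y\<close> with respect
  to the basis given by \<open>R\<close>.\<close>

lemma interval_circuit:
  assumes "b \<le> n" and dep: "q b + a < p a + b"
    and p_a: "p (Suc a) = p a" and q_b: "q (b - 1) = q b"
    and x: "a < x" and y: "x < y" "y \<le> b"
  obtains C where "circuit M C" "C \<subseteq> {a<..b}" "x \<in> C" "y \<in> C"
proof -
  \<comment> \<open>The lower bound for paths that must reach \<open>q b\<close> at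
    \<open>b\<close>: the higher of \<open>p\<close> and the slope-one line ending at that
    point.\<close>
  define l where "l = (\<lambda>k. max (p k) (q b + k - b))"
  have l: "unit_steps l"
    unfolding l_def by (intro unit_steps_max unit_steps_line unit_p)
  have l_step: "l k \<le> l (Suc k)" "l (Suc k) \<le> Suc (l k)" for k
    using l unfolding unit_steps_def by blast+
  \<comment> \<open>By \<open>q_b\<close>, the height \<open>q b\<close> is reached already at
    \<open>b - 1\<close>, so \<open>q\<close> stays strictly above the line.\<close>
  have l_less_q: "l k < q k" if "a < k" "k < b" for k
  proof -
    have "p k < q k"
      using p_less_q that \<open>b \<le> n\<close> by simp
    moreover have "q (b - 1) + k \<le> q k + (b - 1)"
      using q_lipschitz[of k "b - 1"] that by simp
    ultimately show ?thesis
      using that q_b by (auto simp: l_def)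
  qed
  \<comment> \<open>\<open>l\<close> raised by one on \<open>{x..<y}\<close>. Before
    \<open>x\<close> the path joins a slope-one line to the new height; from \<open>y\<close> on it
    goes East until \<open>l\<close> has caught up.\<close>
  define R where "R = (\<lambda>k. if k < x then max (l k) (Suc (l x) + k - x)
    else if k < y then Suc (l k) else max (l k) (Suc (l (y - 1))))"
  have R: "unit_steps R"
    unfolding unit_steps_def
  proof
    fix k
    consider "Suc k < x" | "Suc k = x" | "x \<le> k" "Suc k < y" | "Suc k = y" | "y \<le> k"
      by linarith
    then show "R k \<le> R (Suc k) \<and> R (Suc k) \<le> Suc (R k)"
    proof cases
      case 1
      then show ?thesis
        using l_step[of k] unfolding R_def by simp linarith
    next
      case 2
      then show ?thesis
        using l_step[of k] y unfolding R_def by auto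
    next
      case 3
      then show ?thesis
        using l_step[of k] unfolding R_def by simp
    next
      case 4
      then show ?thesis
        using l_step[of k] y unfolding R_def by auto
    next
      case 5
      then show ?thesis
        using l_step[of k] y unfolding R_def by simp linarith
    qed
  qed
  have R_x: "R (x - 1) < R x"
    using x y l_step[of "x - 1"] by (simp add: R_def)
  have R_y: "R (y - 1) = R y"
    using x y l_step[of "y - 1"] by (simp add: R_def)
  \<comment> \<open>By \<open>p_a\<close>, the line through height \<open>Suc (p x)\<close> at
    \<open>x\<close> is at most \<open>p a\<close> at \<open>a\<close>; if \<open>l x\<close> comes
    from the other line, strictness of \<open>dep\<close> ensures this.\<close>
  have "p x + Suc a \<le> p (Suc a) + x"
    using p_lipschitz[of "Suc a" x] x by simp
  then have R_a: "R a = p a"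
    using x p_a dep by (auto simp: R_def l_def max_def)
  have "l (y - 1) < q (y - 1)"
    using x y by (intro l_less_q) auto
  moreover have "q (y - 1) \<le> q b"
    using y by (auto intro: q_mono)
  moreover have "l b = q b"
    using p_le_q[of b] by (simp add: l_def)
  ultimately have R_b: "R b = q b"
    using x y by (simp add: R_def)
  have p_R: "p k \<le> R k" for k
    by (auto simp: R_def l_def max_def)
  have p_R': "p k < R k" if "x \<le> k" "k < y" for k
    using that by (auto simp: R_def l_def)
  have R_q: "R k \<le> q k" if k: "a \<le> k" "k \<le> b" for k
  proof -
    consider "k = a" | "k = b" | "a < k" "k < b"
      using k by linarith
    then show ?thesis
    proof cases
      case 1
      then show ?thesis
        using R_a p_le_q by simp
    next
      case 2
      then show ?thesis
        using R_b by simp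
    next
      case 3
      have "l x < q x" "l (y - 1) < q (y - 1)"
        using x y by (auto intro!: l_less_q)
      moreover have "q x + k \<le> q k + x" if "k < x"
        using q_lipschitz[of k x] that by simp
      moreover have "q (y - 1) \<le> q k" if "y \<le> k"
        using that by (auto intro: q_mono)
      ultimately show ?thesis
        using l_less_q[OF 3] by (auto simp: R_def)
    qed
  qed
  define B where "B = rises R \<inter> {a<..b}"
  have count_B: "p a + card (B \<inter> {a<..k}) = R k" if "a \<le> k" "k \<le> b" for k
  proof -
    have "B \<inter> {a<..k} = rises R \<inter> {a<..k}"
      using that by (auto simp: B_def)
    then show ?thesis
      using card_rises[OF R that(1)] R_a by simp
  qed
  have B: "B \<subseteq> {a<..b}" "finite B" "indep M B" "p a + card B = q b"
  proof -
    show "B \<subseteq> {a<..b}" "finite B"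
      by (auto simp: B_def)
    show "indep M B"
      unfolding B_def using x y \<open>b \<le> n\<close> p_R R_q by (intro indep_rises R) auto
    have "B \<inter> {a<..b} = B"
      by (auto simp: B_def)
    then show "p a + card B = q b"
      using count_B[of b] R_b x y by simp
  qed
  have "x \<in> B" "y \<notin> B"
    using R_x R_y x y by (auto simp: B_def rises_def)
  \<comment> \<open>The exchange lowers the count by one exactly on \<open>{x..<y}\<close>, where
    \<open>R\<close> lies strictly above \<open>p\<close>.\<close>
  have exchange: "indep M (insert y (B - {x}))"
  proof (rule indep_between[where d = "p a"])
    show "insert y (B - {x}) \<subseteq> {a<..b}" "b \<le> n"
      using B(1) x y \<open>b \<le> n\<close> by auto
    fix k
    assume k: "a \<le> k" "k \<le> b"
    have finB: "finite (B \<inter> {a<..k})"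
      by simp
    consider "k < x" | "x \<le> k" "k < y" | "y \<le> k"
      by linarith
    then have "p k \<le> p a + card (insert y (B - {x}) \<inter> {a<..k}) \<and>
      p a + card (insert y (B - {x}) \<inter> {a<..k}) \<le> R k"
    proof cases
      case 1
      then have "insert y (B - {x}) \<inter> {a<..k} = B \<inter> {a<..k}"
        using y by auto
      then show ?thesis
        using count_B[OF k] p_R by simp
    next
      case 2
      then have "insert y (B - {x}) \<inter> {a<..k} = B \<inter> {a<..k} - {x}" "x \<in> B \<inter> {a<..k}"
        using x \<open>x \<in> B\<close> by auto
      then have "Suc (card (insert y (B - {x}) \<inter> {a<..k})) = card (B \<inter> {a<..k})"
        using card.remove[OF finB, of x] by simp
      then show ?thesis
        using count_B[OF k] p_R'[OF 2] by linarith
    next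
      case 3
      then have "insert y (B - {x}) \<inter> {a<..k} = insert y (B \<inter> {a<..k} - {x})"
        "x \<in> B \<inter> {a<..k}" "y \<notin> B \<inter> {a<..k} - {x}"
        using x y \<open>x \<in> B\<close> \<open>y \<notin> B\<close> by auto
      then have "card (insert y (B - {x}) \<inter> {a<..k}) = card (B \<inter> {a<..k})"
        using card.remove[OF finB, of x] by simp
      then show ?thesis
        using count_B[OF k] p_R by simp
    qed
    then show "p k \<le> p a + card (insert y (B - {x}) \<inter> {a<..k}) \<and>
        p a + card (insert y (B - {x}) \<inter> {a<..k}) \<le> q k"
      using R_q[OF k] by linarith
  qed
  have sub: "insert y B \<subseteq> {a<..b}"
    using B(1) x y by auto
  have "\<not> indep M (insert y B)"
    using indep_card[of "insert y B" a b] sub B \<open>y \<notin> B\<close> x y by auto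
  moreover have "insert y B \<subseteq> ground M"
    using sub \<open>b \<le> n\<close> unfolding ground by force
  ultimately obtain C where C: "C \<subseteq> insert y B" "circuit M C"
    using dependent_contains_circuit[OF matroid] by blast
  have "\<not> indep M C"
    using C(2) unfolding circuit_def by blast
  \<comment> \<open>A circuit missing \<open>y\<close> would lie in \<open>B\<close>, one missing
    \<open>x\<close> in \<open>insert y (B - {x})\<close>.\<close>
  then have "\<not> C \<subseteq> B" "\<not> C \<subseteq> insert y (B - {x})"
    using indep_subset[OF matroid] B(3) exchange by blast+
  then have "x \<in> C" "y \<in> C"
    using C(1) by auto
  then show ?thesis
    using that C sub by blast
qed

lemma interval_connected:
  assumes "b \<le> n" "q b + a < p a + b" "p (Suc a) = p a" "q (b - 1) = q b"
  shows "connected_matroid (restriction M {a<..b})"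
  unfolding connected_matroid_def
proof (intro ballI impI)
  fix x y
  assume "x \<in> ground (restriction M {a<..b})" "y \<in> ground (restriction M {a<..b})" "x \<noteq> y"
  then have xy: "x \<in> {a<..b}" "y \<in> {a<..b}" "x < y \<or> y < x"
    by (auto simp: restriction_def)
  then have "\<exists>C. circuit M C \<and> C \<subseteq> {a<..b} \<and> x \<in> C \<and> y \<in> C"
    using interval_circuit[OF assms, of x y] interval_circuit[OF assms, of y x] by auto metis+
  then show "\<exists>C. circuit (restriction M {a<..b}) C \<and> x \<in> C \<and> y \<in> C"
    by (auto simp: circuit_restriction)
qed

text \<open>Deleting an end from a circuit through both ends leaves an independent set in a shorter
  interval. By \<open>circuit_card\<close> it would be too large if \<open>P\<close> went North at
  \<open>Suc a\<close> or \<open>Q\<close> at \<open>b\<close>.\<close>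

lemma interval_connected_ends:
  assumes conn: "connected_matroid (restriction M {a<..b})" and "Suc a < b" "b \<le> n"
  shows "p (Suc a) = p a" "q (b - 1) = q b"
proof -
  obtain C where C: "C \<subseteq> {a<..b}" "circuit M C" "Suc a \<in> C" "b \<in> C"
    using connected_restriction_circuit[OF conn, of "Suc a" b] assms(2,3) ground by force
  have ind: "indep M (C - {z})" if "z \<in> C" for z
    using C(2) that unfolding circuit_def by blast
  have "finite C"
    using C(1) by (rule finite_subset) simp
  have "C \<subseteq> {Suc a..b}"
    using C(1) by auto
  then have card: "p a + card C = Suc (q b)"
    using circuit_card[OF C(2-4)] by simp
  have "p (Suc a) + card (C - {Suc a}) \<le> q b"
  proof (rule indep_card[OF ind[OF C(3)]])
    show "C - {Suc a} \<subseteq> {Suc a<..b}" "Suc a \<le> b"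
      using C(1) \<open>Suc a < b\<close> by fastforce+
  qed
  then show "p (Suc a) = p a"
    using card card.remove[OF \<open>finite C\<close> C(3)] p_mono[of a "Suc a"] by simp
  have "p a + card (C - {b}) \<le> q (b - 1)"
  proof (rule indep_card[OF ind[OF C(4)]])
    show "C - {b} \<subseteq> {a<..b - 1}" "a \<le> b - 1"
      using C(1) \<open>Suc a < b\<close> by fastforce+
  qed
  then show "q (b - 1) = q b"
    using card card.remove[OF \<open>finite C\<close> C(4)] q_mono[of "b - 1" b] by simp
qed

section \<open>Intervals that are flats\<close>

text \<open>If \<open>P\<close> goes East at \<open>a > 0\<close>, then \<open>{a - 1<..b}\<close>
  has the same rank bound as \<open>{a<..b}\<close>, so \<open>a\<close> adds no rank; likewise for
  \<open>Suc b\<close>. Conversely, with both corners a basis of the interval stays independent when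
  any outside \<open>z\<close> is added.\<close>

lemma interval_flat_iff:
  assumes "a < b" "b \<le> n" and dep: "q b + a \<le> p a + b"
  shows "flat M {a<..b} \<longleftrightarrow> (a = 0 \<or> p (a - 1) < p a) \<and> (b = n \<or> q b < q (Suc b))"
proof
  assume flat: "flat M {a<..b}"
  have rk: "rk M {a<..b} + p a = q b"
    using assms by (intro rk_interval) auto
  have less: "rk M {a<..b} < rk M (insert z {a<..b})" if "z \<in> {1..n}" "z \<notin> {a<..b}" for z
    using flat that unfolding flat_def ground by blast
  show "(a = 0 \<or> p (a - 1) < p a) \<and> (b = n \<or> q b < q (Suc b))"
  proof (intro conjI)
    show "a = 0 \<or> p (a - 1) < p a"
    proof (cases "a = 0")
      case False
      then have "insert a {a<..b} \<subseteq> {a - 1<..b}"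
        using \<open>a < b\<close> by auto
      then have "rk M (insert a {a<..b}) + p (a - 1) \<le> q b"
        using \<open>a < b\<close> by (intro rk_le_interval) auto
      then show ?thesis
        using less[of a] rk False assms by simp
    qed simp
    show "b = n \<or> q b < q (Suc b)"
    proof (cases "b = n")
      case False
      have "rk M (insert (Suc b) {a<..b}) + p a \<le> q (Suc b)"
        using \<open>a < b\<close> by (intro rk_le_interval) auto
      then show ?thesis
        using less[of "Suc b"] rk False assms by simp
    qed simp
  qed
next
  assume ends: "(a = 0 \<or> p (a - 1) < p a) \<and> (b = n \<or> q b < q (Suc b))"
  obtain B where B: "B \<subseteq> {a<..b}" "indep M B" "p a + card B = q b"
    using interval_basis assms by (metis less_imp_le)
  have rk: "rk M {a<..b} = card B"
    using rk_interval[of a b] assms B(3) by simp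
  have "finite B"
    using B(1) by (rule finite_subset) simp
  show "flat M {a<..b}"
    unfolding flat_def
  proof (intro conjI ballI)
    show "{a<..b} \<subseteq> ground M"
      unfolding ground using \<open>b \<le> n\<close> by auto
    fix z
    assume "z \<in> ground M - {a<..b}"
    then have z: "1 \<le> z" "z \<le> n" "z \<le> a \<or> b < z"
      by (auto simp: ground)
    have "indep M (insert z B)"
      unfolding indep_iff
    proof (intro conjI allI impI)
      show "insert z B \<subseteq> {1..n}"
        using B(2) z indep_iff by simp
      fix s t :: nat
      assume "s \<le> t"
      have fin: "finite (B \<inter> {s<..t})"
        by simp
      have le: "p s' + card (B \<inter> {s'<..t'}) \<le> q t'" if "s' \<le> t'" for s' t'
        using B(2) that unfolding indep_iff by blast
      show "p s + card (insert z B \<inter> {s<..t}) \<le> q t"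
      proof (cases "s < z \<and> z \<le> t")
        case False
        then have "insert z B \<inter> {s<..t} = B \<inter> {s<..t}"
          by auto
        then show ?thesis
          using le \<open>s \<le> t\<close> by simp
      next
        case True
        then have "insert z B \<inter> {s<..t} = insert z (B \<inter> {s<..t})"
          by auto
        then have card: "card (insert z B \<inter> {s<..t}) \<le> Suc (card (B \<inter> {s<..t}))"
          using card_insert_le_m1 by (simp add: card_insert_if)
        \<comment> \<open>A window that contains \<open>z\<close> and meets \<open>B\<close> crosses
          the end of the interval on the side of \<open>z\<close>, where the corner provides one
          extra unit. Otherwise the window counts \<open>z\<close> alone.\<close>
        consider "B \<inter> {s<..t} = {}" | "b < z" "s < b" | "z \<le> a" "a < t"
          using z(3) B(1) True by force
        then show ?thesis
        proof cases
          case 1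
          have "p s \<le> p (z - 1)" "q z \<le> q t"
            using True by (auto intro: p_mono q_mono)
          then show ?thesis
            using card p_pred_less_q[of z] z 1 by simp
        next
          case 2
          then have "q b < q (Suc b)" "q (Suc b) \<le> q t"
            using ends z True by (auto intro: q_mono)
          moreover have "B \<inter> {s<..t} = B \<inter> {s<..b}"
            using B(1) True 2 by auto
          ultimately show ?thesis
            using card le[of s b] 2 by simp
        next
          case 3
          then have "p (a - 1) < p a" "p s \<le> p (a - 1)"
            using ends z True by (auto intro: p_mono)
          moreover have "B \<inter> {s<..t} = B \<inter> {a<..t}"
            using B(1) True 3 by auto
          ultimately show ?thesis
            using card le[of a t] 3 by simp
        qed
      qed
    qed
    then have "card (insert z B) \<le> rk M (insert z {a<..b})"
      using B(1) by (intro card_le_rk[OF matroid]) auto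
    moreover have "z \<notin> B"
      using B(1) z(3) by auto
    ultimately show "rk M {a<..b} < rk M (insert z {a<..b})"
      using rk \<open>finite B\<close> by simp
  qed
qed

section \<open>Connected flats in terms of corners\<close>

text \<open>After \<open>b \<le> n\<close> come dependence, the two East steps that connectedness
  requires, and the two North steps that flatness requires.\<close>

definition corners :: "nat \<Rightarrow> nat \<Rightarrow> bool" where
  "corners a b \<longleftrightarrow> b \<le> n \<and> q b + a < p a + b \<and> p (Suc a) = p a \<and> q (b - 1) = q b \<and>
     (a = 0 \<or> p (a - 1) < p a) \<and> (b = n \<or> q b < q (Suc b))"

lemma corners_less:
  assumes "corners a b"
  shows "a < b"
proof (rule ccontr)
  assume "\<not> a < b"
  then have "p a + b \<le> p b + a"
    by (intro p_lipschitz) simp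
  then show False
    using assms p_le_q[of b] unfolding corners_def by linarith
qed

lemma corners_connected_flat:
  assumes "corners a b"
  shows "connected_flat M {a<..b}" "nontrivial M {a<..b}"
proof -
  have "b \<le> n" "q b + a < p a + b"
    using assms by (auto simp: corners_def)
  moreover have "{a<..b} \<subseteq> ground M"
    unfolding ground using \<open>b \<le> n\<close> by auto
  ultimately show "connected_flat M {a<..b}" "nontrivial M {a<..b}"
    using assms corners_less[OF assms] interval_connected[of b a] interval_flat_iff[of a b]
      dependent_interval[of a b]
    unfolding corners_def connected_flat_def nontrivial_def by auto
qed

lemma nonloop: "x \<in> ground M \<Longrightarrow> indep M {x}"
proof -
  assume x: "x \<in> ground M"
  define y where "y = (if x = 1 then 2 else 1 :: nat)"
  have "y \<in> ground M" "x \<noteq> y"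
    using n_ge_2 by (auto simp: ground y_def)
  then obtain C where "circuit M C" "x \<in> C" "y \<in> C"
    using connected x unfolding connected_matroid_def by blast
  moreover then have "{x} \<subset> C"
    using \<open>x \<noteq> y\<close> by blast
  ultimately show ?thesis
    unfolding circuit_def by blast
qed

lemma connected_flat_interval:
  assumes "connected_flat M X" "nontrivial M X"
  obtains a b where "X = {a<..b}" "Suc a < b" "b \<le> n"
proof -
  have flat: "flat M X" and conn: "connected_matroid (restriction M X)"
    using assms(1) by (auto simp: connected_flat_def)
  have X: "X \<subseteq> {1..n}" "\<not> indep M X"
    using assms(2) by (auto simp: nontrivial_def ground)
  have fin: "finite X"
    using X(1) by (rule finite_subset) simp
  have "X \<noteq> {}"
    using X(2) indep_empty[OF matroid] by blast
  define x y where "x = Min X" and "y = Max X"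
  have xy: "x \<in> X" "y \<in> X" "X \<subseteq> {x..y}"
    using fin \<open>X \<noteq> {}\<close> by (auto simp: x_def y_def)
  have "x \<noteq> y"
  proof
    assume "x = y"
    then have "X = {x}"
      using xy by auto
    then show False
      using X nonloop[of x] by (simp add: ground)
  qed
  then obtain C where C: "C \<subseteq> X" "circuit M C" "x \<in> C" "y \<in> C"
    using connected_restriction_circuit[OF conn] X(1) xy ground by metis
  have "x < y"
    using xy(2,3) \<open>x \<noteq> y\<close> by (auto simp: less_le)
  have card: "p (x - 1) + card C = Suc (q y)"
    using circuit_card[OF C(2-4)] C(1) xy(3) by blast
  have "{x..y} \<subseteq> X"
  proof
    fix z
    assume z: "z \<in> {x..y}"
    show "z \<in> X"
    proof (rule ccontr)
      assume "z \<notin> X"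
      have "indep M (C - {x})"
        using C(2,3) unfolding circuit_def by blast
      moreover have "z \<in> ground M - X"
        using \<open>z \<notin> X\<close> z X(1) xy(1,2) ground by fastforce
      \<comment> \<open>This set is as large as \<open>C\<close> and lies in
        \<open>{x - 1<..y}\<close>, where independent sets have fewer than \<open>card C\<close>
        elements.\<close>
      ultimately have "indep M (insert z (C - {x}))"
        using flat_indep_insert[OF matroid flat] C(1) by blast
      moreover have "0 < x"
        using X(1) xy(1) by auto
      then have "{x..y} \<subseteq> {x - 1<..y}"
        by auto
      then have "insert z (C - {x}) \<subseteq> {x - 1<..y}" 
        using z C(1) xy(3) by blast
      moreover have "x - 1 \<le> y"
        using \<open>x < y\<close> by simp
      ultimately have "p (x - 1) + card (insert z (C - {x})) \<le> q y"
        by (rule indep_card)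
      moreover have "card (insert z (C - {x})) = card C"
        using \<open>z \<notin> X\<close> C(1,3) finite_subset[OF C(1) fin]
        by (metis Diff_subset card.remove card_insert_disjoint finite_Diff subsetD)
      ultimately show False
        using card by simp
    qed
  qed
  then have "X = {x..y}"
    using xy(3) by blast
  moreover have "0 < x"
    using X(1) xy(1) by auto
  ultimately have "X = {x - 1<..y}"
    by auto
  moreover have "Suc (x - 1) < y" "y \<le> n"
    using X(1) xy \<open>x < y\<close> by auto
  ultimately show ?thesis
    using that by blast
qed

lemma connected_flat_iff:
  "connected_flat M X \<and> nontrivial M X \<longleftrightarrow> (\<exists>a b. X = {a<..b} \<and> corners a b)"
proof
  assume X: "connected_flat M X \<and> nontrivial M X"
  then obtain a b where ab: "X = {a<..b}" "Suc a < b" "b \<le> n"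
    using connected_flat_interval by blast
  moreover have "q b + a < p a + b"
    using X ab dependent_interval[of a b] by (auto simp: nontrivial_def)
  ultimately have "corners a b"
    using X interval_connected_ends[of a b] interval_flat_iff[of a b]
    unfolding corners_def connected_flat_def by auto
  then show "\<exists>a b. X = {a<..b} \<and> corners a b"
    using ab by blast
qed (use corners_connected_flat in blast)

lemma ground_eq: "ground M = {0<..n}"
  unfolding ground by (simp add: atLeastSucAtMost_greaterThanAtMost)

lemma interval_eq: "(a :: nat) < b \<Longrightarrow> {a<..b} = {c<..d} \<longleftrightarrow> a = c \<and> b = d"
  by (simp add: Ioc_inj)

text \<open>The conditions at \<open>a\<close> and at \<open>b\<close> do not interact, and at
  \<open>0\<close> and \<open>n\<close> they hold because \<open>P\<close> starts and
  \<open>Q\<close> ends with East. The East steps after \<open>a\<close> and into \<open>b\<close>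
  make the two longer intervals dependent.\<close>

lemma corners_split: "corners a b \<longleftrightarrow> corners 0 b \<and> corners a n \<and> q b + a < p a + b"
proof
  assume ab: "corners a b"
  then have "a < b"
    by (rule corners_less)
  moreover have "b \<le> n" "q (b - 1) = q b" "p (Suc a) = p a"
    using ab by (simp_all add: corners_def)
  ultimately have "q b + 0 < p 0 + b" "q n + a < p a + n"
    using q_lipschitz[of 0 "b - 1"] p_lipschitz[of "Suc a" n] p_0 q_0 p_n q_n by simp_all
  then show "corners 0 b \<and> corners a n \<and> q b + a < p a + b"
    using ab p_0 p_1 q_n q_pred_n unfolding corners_def by simp
qed (auto simp: corners_def)

lemma nullity_corners:
  assumes "corners a b"
  shows "nullity M {a<..b} + a + q b = p a + b" "rk M {a<..b} + p a = q b"
proof -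
  show rk: "rk M {a<..b} + p a = q b"
    using assms corners_less[OF assms] unfolding corners_def by (intro rk_interval) auto
  then show "nullity M {a<..b} + a + q b = p a + b"
    using assms corners_less[OF assms] unfolding corners_def nullity_def by simp
qed

end


section \<open>Fundamental flats\<close>

context connected_paths
begin

text \<open>Deleting \<open>x\<close> lowers the counting function by one from \<open>x\<close> on,
  and the strict lower inequality leaves room for that. So each \<open>C - {x}\<close> is
  independent of size \<open>r\<close>, while \<open>C\<close> is too large.\<close>

lemma spanning_circuit_between:
  assumes C: "C \<subseteq> {0<..n}" "card C = Suc r"
    and between: "\<And>k. 0 < k \<Longrightarrow> k < n \<Longrightarrow>
      p k < card (C \<inter> {0<..k}) \<and> card (C \<inter> {0<..k}) \<le> q k"
  shows "circuit M C" "spanning M C"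
proof -
  have ind: "indep M (C - {x})" if "x \<in> C" for x
  proof (rule indep_between[where a = 0 and b = n and d = 0])
    show "C - {x} \<subseteq> {0<..n}" "n \<le> n"
      using C(1) by auto
    fix k
    assume "k \<le> n"
    have x: "0 < x" "x \<le> n"
      using that C(1) by auto
    have "p k \<le> card ((C - {x}) \<inter> {0<..k}) \<and> card ((C - {x}) \<inter> {0<..k}) \<le> q k"
    proof (cases "k < x")
      case True
      then have eq: "(C - {x}) \<inter> {0<..k} = C \<inter> {0<..k}"
        by auto
      show ?thesis
      proof (cases "k = 0")
        case True
        then show ?thesis
          using p_0 by simp
      next
        case False
        then show ?thesis
          unfolding eq using between[of k] \<open>k < x\<close> x by simp
      qed
    next
      case False
      then have "(C - {x}) \<inter> {0<..k} = C \<inter> {0<..k} - {x}" "x \<in> C \<inter> {0<..k}"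
        using that x by auto
      then have card: "Suc (card ((C - {x}) \<inter> {0<..k})) = card (C \<inter> {0<..k})"
        using card.remove[of "C \<inter> {0<..k}" x] by simp
      show ?thesis
      proof (cases "k = n")
        case True
        then have "C \<inter> {0<..k} = C"
          using C(1) by blast
        then show ?thesis
          using card C(2) p_n q_n True by simp
      next
        case False
        then show ?thesis
          using card between[of k] x \<open>\<not> k < x\<close> \<open>k \<le> n\<close> by simp
      qed
    qed
    then show "p k \<le> 0 + card ((C - {x}) \<inter> {0<..k}) \<and> 0 + card ((C - {x}) \<inter> {0<..k}) \<le> q k"
      by simp
  qed
  have "\<not> indep M C"
    using indep_card[of C 0 n] C q_n by auto
  moreover have "indep M D" if "D \<subset> C" for D
  proof -
    obtain x where x: "x \<in> C" "x \<notin> D"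
      using \<open>D \<subset> C\<close> by blast
    have "D \<subseteq> C - {x}"
      using x(2) \<open>D \<subset> C\<close> by blast
    then show ?thesis
      by (rule indep_subset[OF matroid ind[OF x(1)]])
  qed
  ultimately show "circuit M C"
    using C(1) unfolding circuit_def ground_eq by blast
  obtain x where x: "x \<in> C"
    using C(2) by fastforce
  have "finite C"
    using C(1) by (rule finite_subset) simp
  then have "card (C - {x}) = r"
    using C(2) x by simp
  then have "r \<le> rk M C"
    using card_le_rk[OF matroid ind[OF x], of C] by auto
  then show "spanning M C"
    using rk_le_interval[OF C(1)] rk_ground C(1) q_n unfolding spanning_def ground_eq by simp
qed

lemma basis_interval:
  assumes "indep M B" "B \<subseteq> {a<..b}" "a \<le> b" "p a + card B = q b"
  shows "basis (restriction M {a<..b}) B"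
  unfolding basis_def
proof (intro conjI ballI)
  show "indep (restriction M {a<..b}) B"
    using assms(1,2) by (simp add: restriction_def)
  fix x
  assume "x \<in> ground (restriction M {a<..b}) - B"
  then have x: "x \<in> {a<..b}" "x \<notin> B"
    by (auto simp: restriction_def)
  have "card (insert x B) = Suc (card B)"
    using x(2) indep_finite[OF matroid assms(1)] by simp
  then have "\<not> indep M (insert x B)"
    using indep_card[of "insert x B" a b] assms(2-4) x(1) by auto
  then show "\<not> indep (restriction M {a<..b}) (insert x B)"
    by (simp add: restriction_def)
qed

lemma fundamental_initial:
  assumes corners: "corners 0 b" and "b < n"
  shows "fundamental_flat M {0<..b}"
proof -
  define C where "C = insert n (rises q \<inter> {0<..n})"
  have "n \<notin> rises q"
    using q_pred_n q_n by (simp add: rises_def)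
  have count: "card (rises q \<inter> {0<..k}) = q k" for k
    using card_rises[OF unit_q, of 0 k] q_0 by simp
  have count_C: "C \<inter> {0<..k} = rises q \<inter> {0<..k}" if "k < n" for k
    using that by (auto simp: C_def)
  have "C \<subseteq> {0<..n}" "card C = Suc r"
    using n_ge_2 \<open>n \<notin> rises q\<close> count[of n] q_n by (auto simp: C_def)
  then have C: "circuit M C" "spanning M C"
    using spanning_circuit_between[of C] count_C count p_less_q by auto
  \<comment> \<open>As \<open>b < n\<close>, the added element \<open>n\<close> lies outside the
    flat, so \<open>C\<close> meets it in the \<open>q b\<close> North steps of \<open>Q\<close> up
    to \<open>b\<close>.\<close>
  have "basis (restriction M {0<..b}) (rises q \<inter> {0<..b})"
    using assms(2) p_le_q p_0 count by (intro basis_interval indep_rises unit_q) auto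
  then have "basis (restriction M {0<..b}) ({0<..b} \<inter> C)"
    using count_C[OF \<open>b < n\<close>] by (simp add: Int_commute)
  \<comment> \<open>If \<open>b = 1\<close>, then \<open>Q\<close> starts East, against
    \<open>p 1 < q 1\<close>.\<close>
  moreover have "b \<noteq> 1"
    using corners p_less_q[of 1] n_ge_2 q_0 by (auto simp: corners_def)
  moreover have "0 < b"
    using corners_less[OF corners] .
  moreover have "rk M {0<..b} < rk M (ground M)"
    using nullity_corners(2)[OF corners] corners \<open>b < n\<close> q_mono[of "Suc b" n] rk_ground q_n
    unfolding corners_def by simp
  ultimately show ?thesis
    using corners_connected_flat[OF corners] C unfolding fundamental_flat_def by auto
qed

lemma fundamental_final:
  assumes corners: "corners a n" and "0 < a"
  shows "fundamental_flat M {a<..n}"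
proof -
  have "a < n"
    using corners_less[OF corners] .
  define C where "C = insert 1 (rises p \<inter> {0<..n})"
  have "1 \<notin> rises p"
    using p_1 by (simp add: rises_def)
  have count: "card (rises p \<inter> {0<..k}) = p k" for k
    using card_rises[OF unit_p, of 0 k] p_0 by simp
  \<comment> \<open>\<open>P\<close> starts East, so \<open>1\<close> is a new element and lifts the
    whole path by one, which still fits below \<open>q\<close>.\<close>
  have count_C: "card (C \<inter> {0<..k}) = Suc (p k)" if "0 < k" "k \<le> n" for k
  proof -
    have "C \<inter> {0<..k} = insert 1 (rises p \<inter> {0<..k})"
      using that by (auto simp: C_def)
    then show ?thesis
      using \<open>1 \<notin> rises p\<close> count by simp
  qed
  have sub: "C \<subseteq> {0<..n}"
    using n_ge_2 by (auto simp: C_def)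
  then have "card C = Suc r"
    using count_C[of n] n_ge_2 p_n by (simp add: Int_absorb2)
  then have C: "circuit M C" "spanning M C"
    using spanning_circuit_between[of C] sub count_C p_less_q by (auto simp: Suc_le_eq)
  have "p a + card (rises p \<inter> {a<..n}) = q n"
    using card_rises[OF unit_p, of a n] \<open>a < n\<close> p_n q_n by simp
  then have "basis (restriction M {a<..n}) (rises p \<inter> {a<..n})"
    using \<open>a < n\<close> p_le_q by (intro basis_interval indep_rises unit_p) auto
  moreover have "{a<..n} \<inter> C = rises p \<inter> {a<..n}"
    using \<open>0 < a\<close> by (auto simp: C_def)
  ultimately have "basis (restriction M {a<..n}) ({a<..n} \<inter> C)"
    by simp
  \<comment> \<open>Otherwise the last step of \<open>P\<close> is East and the paths already meet
    at \<open>n - 1\<close>.\<close>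
  moreover have "Suc a \<noteq> n"
    using corners p_less_q[of a] \<open>0 < a\<close> \<open>a < n\<close> p_n p_le_q[of a] q_n q_mono[of a n]
    by (auto simp: corners_def)
  moreover have "p (a - 1) < p a"
    using corners \<open>0 < a\<close> by (simp add: corners_def)
  then have "rk M {a<..n} < rk M (ground M)"
    using nullity_corners(2)[OF corners] rk_ground q_n by simp
  ultimately show ?thesis
    using corners_connected_flat[OF corners] C \<open>a < n\<close> unfolding fundamental_flat_def by auto
qed

lemma connected_flat_nontrivial:
  assumes "connected_flat M X" "1 < card X"
  shows "nontrivial M X"
proof -
  have X: "X \<subseteq> ground M" "connected_matroid (restriction M X)"
    using assms(1) unfolding connected_flat_def flat_def by auto
  then have "finite X"
    using finite_subset finite_ground[OF matroid] by blast
  then obtain x y where "x \<in> X" "y \<in> X" "x \<noteq> y"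
    using assms(2) card_le_Suc0_iff_eq[of X] by auto
  then obtain C where "C \<subseteq> X" "circuit M C"
    using connected_restriction_circuit[OF X(2,1)] by metis
  then have "\<not> indep M X"
    using indep_subset[OF matroid, of X C] unfolding circuit_def by (elim conjE) (rule notI, simp)
  then show ?thesis
    using X(1) by (simp add: nontrivial_def)
qed

lemma fundamental_corners:
  assumes "fundamental_flat M X"
  obtains a b where "X = {a<..b}" "corners a b" "\<not> (a = 0 \<and> b = n)"
proof -
  have "connected_flat M X \<and> nontrivial M X" "rk M X < rk M (ground M)"
    using assms connected_flat_nontrivial unfolding fundamental_flat_def by auto
  then show ?thesis
    using that unfolding connected_flat_iff ground_eq by blast
qed

lemma fundamental_initial_iff:
  "fundamental_flat M X \<and> initial_segment X \<longleftrightarrow> (\<exists>b<n. X = {0<..b} \<and> corners 0 b)"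
proof
  assume X: "fundamental_flat M X \<and> initial_segment X"
  then obtain a b where ab: "X = {a<..b}" "corners a b" "\<not> (a = 0 \<and> b = n)"
    using fundamental_corners by blast
  obtain c where "X = {0<..c}"
    using X unfolding initial_segment_def by (auto simp: atLeastSucAtMost_greaterThanAtMost)
  then have "a = 0"
    using ab(1) interval_eq[OF corners_less[OF ab(2)]] by metis
  moreover have "b \<le> n"
    using ab(2) by (simp add: corners_def)
  ultimately show "\<exists>b<n. X = {0<..b} \<and> corners 0 b"
    using ab by (auto simp: le_less)
next
  assume "\<exists>b<n. X = {0<..b} \<and> corners 0 b"
  moreover have "{0<..b} = {1..b}" for b :: nat
    by (simp add: atLeastSucAtMost_greaterThanAtMost)
  ultimately show "fundamental_flat M X \<and> initial_segment X"
    using fundamental_initial unfolding initial_segment_def by metis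
qed

lemma fundamental_final_iff:
  "fundamental_flat M X \<and> final_segment n X \<longleftrightarrow> (\<exists>a>0. X = {a<..n} \<and> corners a n)"
proof
  assume X: "fundamental_flat M X \<and> final_segment n X"
  then obtain a b where ab: "X = {a<..b}" "corners a b" "\<not> (a = 0 \<and> b = n)"
    using fundamental_corners by blast
  obtain c where "1 \<le> c" "X = {c..n}"
    using X unfolding final_segment_def by blast
  then have "X = {c - 1<..n}"
    by auto
  then have "b = n"
    using ab(1) interval_eq[OF corners_less[OF ab(2)]] by metis
  then show "\<exists>a>0. X = {a<..n} \<and> corners a n"
    using ab by auto
next
  assume "\<exists>a>0. X = {a<..n} \<and> corners a n"
  moreover have "{a<..n} = {Suc a..n}" "1 \<le> Suc a" for a
    by (simp_all add: atLeastSucAtMost_greaterThanAtMost)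
  ultimately show "fundamental_flat M X \<and> final_segment n X"
    using fundamental_final unfolding final_segment_def by metis
qed

section \<open>Intersections of initial and final flats\<close>

text \<open>The nullities are \<open>b - q b\<close> and \<open>m - (a - p a)\<close>. Their sum
  exceeds \<open>m\<close> iff \<open>a - p a < b - q b\<close>, which is the dependence of
  \<open>{a<..b}\<close>.\<close>

lemma corners_intersection_iff:
  assumes "n = m + r" "corners 0 b" "corners a n"
  shows "m < nullity M {0<..b} + nullity M {a<..n} \<longleftrightarrow> corners a b"
proof -
  have "corners a b \<longleftrightarrow> q b + a < p a + b"
    using corners_split[of a b] assms(2,3) by blast
  then show ?thesis
    using nullity_corners(1)[OF assms(2)] nullity_corners(1)[OF assms(3)] assms(1) p_0 q_n
    by linarith
qed

text \<open>A proper \<open>{a<..b}\<close> with corners is some \<open>F i\<close> if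
  \<open>a = 0\<close>, some \<open>G j\<close> if \<open>b = n\<close>, and otherwise the
  intersection of \<open>{0<..b}\<close> and \<open>{a<..n}\<close>, which have corners by
  \<open>corners_split\<close>.\<close>

lemma connected_flats:
  assumes n: "n = m + r"
    and F: "F ` I = {X. fundamental_flat M X \<and> initial_segment X}"
    and G: "G ` J = {X. fundamental_flat M X \<and> final_segment n X}"
  shows "{X. connected_flat M X \<and> nontrivial M X \<and> X \<noteq> ground M} =
      F ` I \<union> G ` J \<union>
      {F i \<inter> G j |i j. i \<in> I \<and> j \<in> J \<and> m < nullity M (F i) + nullity M (G j)}"
    and "i \<in> I \<Longrightarrow> j \<in> J \<Longrightarrow> connected_flat M (F i \<inter> G j) \<Longrightarrow> nontrivial M (F i \<inter> G j) \<Longrightarrow>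
      int (rk M (F i \<inter> G j)) = int (rk M (F i)) + int (rk M (G j)) - int r"
proof -
  have F: "F ` I = {{0<..b} |b. b < n \<and> corners 0 b}"
    unfolding F fundamental_initial_iff by blast
  have G: "G ` J = {{a<..n} |a. 0 < a \<and> corners a n}"
    unfolding G fundamental_final_iff by blast
  have Int: "{0<..b} \<inter> {a<..n} = {a<..b}" if "b < n" for a b
    using that by auto
  have in_F: "\<exists>b<n. F i = {0<..b} \<and> corners 0 b" if "i \<in> I" for i
    using F that by blast
  have in_G: "\<exists>a>0. G j = {a<..n} \<and> corners a n" if "j \<in> J" for j
    using G that by blast
  have flats: "connected_flat M X \<and> nontrivial M X \<and> X \<noteq> ground M \<longleftrightarrow>
      (\<exists>a b. X = {a<..b} \<and> corners a b \<and> \<not> (a = 0 \<and> b = n))" for X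
  proof
    assume "connected_flat M X \<and> nontrivial M X \<and> X \<noteq> ground M"
    then show "\<exists>a b. X = {a<..b} \<and> corners a b \<and> \<not> (a = 0 \<and> b = n)"
      using connected_flat_iff[of X] unfolding ground_eq by blast
  next
    assume "\<exists>a b. X = {a<..b} \<and> corners a b \<and> \<not> (a = 0 \<and> b = n)"
    then obtain a b where "X = {a<..b}" "corners a b" "\<not> (a = 0 \<and> b = n)"
      by blast
    then show "connected_flat M X \<and> nontrivial M X \<and> X \<noteq> ground M"
      using corners_connected_flat interval_eq[OF corners_less] unfolding ground_eq by metis
  qed
  show "{X. connected_flat M X \<and> nontrivial M X \<and> X \<noteq> ground M} =
      F ` I \<union> G ` J \<union>
      {F i \<inter> G j |i j. i \<in> I \<and> j \<in> J \<and> m < nullity M (F i) + nullity M (G j)}"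
    (is "?L = ?R")
  proof
    show "?L \<subseteq> ?R"
    proof
      fix X
      assume "X \<in> ?L"
      then obtain a b where ab: "X = {a<..b}" "corners a b" "\<not> (a = 0 \<and> b = n)"
        using flats by auto
      have "b \<le> n" "corners 0 b" "corners a n"
        using ab(2) corners_split[of a b] by (auto simp: corners_def)
      consider "a = 0" "b < n" | "b = n" "0 < a" | "0 < a" "b < n"
        using ab(3) \<open>b \<le> n\<close> by linarith
      then show "X \<in> ?R"
      proof cases
        case 1
        then have "X \<in> F ` I"
          unfolding F using ab by blast
        then show ?thesis
          by blast
      next
        case 2
        then have "X \<in> G ` J"
          unfolding G using ab by blast
        then show ?thesis
          by blast
      next
        case 3
        then have "{0<..b} \<in> F ` I" "{a<..n} \<in> G ` J"
          unfolding F G using \<open>corners 0 b\<close> \<open>corners a n\<close> by blast+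
        then obtain i j where ij: "i \<in> I" "j \<in> J" "{0<..b} = F i" "{a<..n} = G j"
          by blast
        then have "X = F i \<inter> G j" "m < nullity M (F i) + nullity M (G j)"
          using Int[OF 3(2), of a] ab corners_intersection_iff[OF n \<open>corners 0 b\<close> \<open>corners a n\<close>]
          by simp_all
        then show ?thesis
          using ij(1,2) by blast
      qed
    qed
    show "?R \<subseteq> ?L"
    proof
      fix X
      assume "X \<in> ?R"
      then consider "X \<in> F ` I" | "X \<in> G ` J"
        | i j where "i \<in> I" "j \<in> J" "X = F i \<inter> G j" "m < nullity M (F i) + nullity M (G j)"
        by blast
      then have "\<exists>a b. X = {a<..b} \<and> corners a b \<and> \<not> (a = 0 \<and> b = n)"
      proof cases
        case 1
        then show ?thesis
          unfolding F by blast
      next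
        case 2
        then show ?thesis
          unfolding G by blast
      next
        case 3
        obtain b where b: "b < n" "F i = {0<..b}" "corners 0 b"
          using in_F 3(1) by blast
        obtain a where a: "0 < a" "G j = {a<..n}" "corners a n"
          using in_G 3(2) by blast
        have "X = {a<..b}" "corners a b"
          using 3(3,4) Int[OF b(1), of a] corners_intersection_iff[OF n b(3) a(3)] a(2) b(2)
          by simp_all
        then show ?thesis
          using a(1) by blast
      qed
      then show "X \<in> ?L"
        using flats by blast
    qed
  qed
  assume "i \<in> I" "j \<in> J" and X: "connected_flat M (F i \<inter> G j)" "nontrivial M (F i \<inter> G j)"
  obtain b where b: "b < n" "F i = {0<..b}" "corners 0 b"
    using in_F \<open>i \<in> I\<close> by blast
  obtain a where a: "0 < a" "G j = {a<..n}" "corners a n"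
    using in_G \<open>j \<in> J\<close> by blast
  have eq: "F i \<inter> G j = {a<..b}"
    using Int[OF b(1)] a(2) b(2) by simp
  obtain a' b' where ab: "{a<..b} = {a'<..b'}" "corners a' b'"
    using X connected_flat_iff[of "{a<..b}"] unfolding eq by blast
  then have "corners a b"
    using interval_eq[OF corners_less[OF ab(2)], of a b] by simp
  \<comment> \<open>The ranks are \<open>q b\<close> and \<open>r - p a\<close>, and
    \<open>q b - p a\<close> for the intersection.\<close>
  then show "int (rk M (F i \<inter> G j)) = int (rk M (F i)) + int (rk M (G j)) - int r"
    using nullity_corners(2)[of a b] nullity_corners(2)[OF b(3)] nullity_corners(2)[OF a(3)]
      p_0 q_n a(2) b(2) eq by simp
qed

end


section \<open>Lattice paths\<close>

text \<open>Past the end of \<open>R\<close> the height stays constant, so bounds can be stated for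
  all \<open>k\<close>.\<close>

definition height :: "step list \<Rightarrow> nat \<Rightarrow> nat" where
  "height R k = count_list (take k R) North"

lemma height_Suc:
  "height R (Suc k) = (if k < length R \<and> R ! k = North then Suc (height R k) else height R k)"
proof (cases "k < length R")
  case True
  then show ?thesis
    by (simp add: height_def take_Suc_conv_app_nth)
qed (simp add: height_def)

lemma unit_steps_height: "unit_steps (height R)"
  unfolding unit_steps_def by (simp add: height_Suc)

lemma height_0: "height R 0 = 0"
  by (simp add: height_def)

lemma count_list_steps: "count_list R East + count_list R North = length R"
proof (induction R)
  case (Cons a R)
  then show ?case
    by (cases a) auto
qed simp

lemma lattice_path_length: "R \<in> lattice_paths m r \<Longrightarrow> length R = m + r"
  using count_list_steps[of R] by (simp add: lattice_paths_def)

lemma lattice_path_height: "R \<in> lattice_paths m r \<Longrightarrow> m + r \<le> k \<Longrightarrow> height R k = r"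
  using lattice_path_length[of R m r] by (simp add: lattice_paths_def height_def)

definition path_of :: "(nat \<Rightarrow> nat) \<Rightarrow> nat \<Rightarrow> step list" where
  "path_of c n = map (\<lambda>k. if c k < c (Suc k) then North else East) [0..<n]"

lemma height_path_of:
  assumes c: "unit_steps c" "c 0 = 0" and "k \<le> n"
  shows "height (path_of c n) k = c k"
  using \<open>k \<le> n\<close>
proof (induction k)
  case (Suc k)
  then have "c (Suc k) = (if path_of c n ! k = North then Suc (c k) else c k)"
    using c(1) unfolding unit_steps_def path_of_def by (simp add: le_antisym Suc_leI)
  then show ?case
    using Suc by (simp add: height_Suc) (simp add: path_of_def)
qed (simp add: height_0 c)

lemma North_set_iff:
  assumes P: "P \<in> lattice_paths m r" and Q: "Q \<in> lattice_paths m r" and "never_above P Q"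
  shows "j \<in> North_set m r P Q i \<longleftrightarrow> 1 \<le> j \<and> j \<le> m + r \<and> height P (j - 1) < i \<and> i \<le> height Q j"
proof
  assume "j \<in> North_set m r P Q i"
  then obtain R where R: "R \<in> lattice_paths m r" "\<And>k. height P k \<le> height R k"
      "\<And>k. height R k \<le> height Q k"
    and j: "1 \<le> j" "j \<le> length R" "R ! (j - 1) = North" "height R j = i"
    unfolding North_set_def paths_between_def never_above_def is_ith_North_def height_def by auto
  have "height R j = Suc (height R (j - 1))"
    using height_Suc[of R "j - 1"] j by simp
  then show "1 \<le> j \<and> j \<le> m + r \<and> height P (j - 1) < i \<and> i \<le> height Q j"
    using j R(2)[of "j - 1"] R(3)[of j] lattice_path_length[OF R(1)] by simp
next
  assume j: "1 \<le> j \<and> j \<le> m + r \<and> height P (j - 1) < i \<and> i \<le> height Q j"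
  \<comment> \<open>The slope-one line that reaches \<open>i\<close> at \<open>j\<close>, clamped
    between \<open>P\<close> and \<open>Q\<close>. The inequalities in \<open>j\<close> make the
    clamping inactive at \<open>j - 1\<close> and \<open>j\<close>, so step \<open>j\<close> is the
    \<open>i\<close>-th North step.\<close>
  define c where "c = (\<lambda>k. max (height P k) (min (height Q k) (i + k - j)))"
  have c: "unit_steps c"
    unfolding c_def by (intro unit_steps_max unit_steps_min unit_steps_line unit_steps_height)
  have PQ: "height P k \<le> height Q k" for k
    using assms(3) unfolding never_above_def height_def by blast
  have c_between: "height P k \<le> c k" "c k \<le> height Q k" for k
    using PQ[of k] by (auto simp: c_def)
  have c_ends: "c 0 = 0" "c (m + r) = r"
    using c_between[of 0] c_between[of "m + r"] lattice_path_height[OF P order_refl]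
      lattice_path_height[OF Q order_refl] height_0 by simp_all
  define R where "R = path_of c (m + r)"
  have len: "length R = m + r"
    by (simp add: R_def path_of_def)
  have height_R: "height R k = c k" if "k \<le> m + r" for k
    unfolding R_def using height_path_of[OF c c_ends(1) that] .
  have "height R (m + r) = r"
    using height_R c_ends(2) by simp
  then have R: "R \<in> lattice_paths m r"
    using count_list_steps[of R] len by (simp add: lattice_paths_def height_def)
  have between: "height P k \<le> height R k" "height R k \<le> height Q k" for k
    using c_between[of k] height_R[of k] lattice_path_height[of _ m r k] P Q R
    by (cases "k \<le> m + r"; simp)+
  have "height P j \<le> Suc (height P (j - 1))" "height Q j \<le> Suc (height Q (j - 1))"
    using unit_steps_height[of P] unit_steps_height[of Q] j unfolding unit_steps_def
    by (metis Suc_diff_1 less_eq_Suc_le One_nat_def)+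
  then have "c (j - 1) = i - 1" "c j = i"
    using j by (auto simp: c_def)
  then have R_j: "height R (j - 1) = i - 1" "height R j = i"
    using height_R j by auto
  have North: "R ! (j - 1) = North"
  proof (rule ccontr)
    assume "R ! (j - 1) \<noteq> North"
    then have "height R (Suc (j - 1)) = height R (j - 1)"
      by (simp only: height_Suc if_False simp_thms)
    moreover have "Suc (j - 1) = j" "0 < i"
      using j by auto
    ultimately show False
      using R_j by simp
  qed
  have "is_ith_North R i j"
    unfolding is_ith_North_def
  proof (intro conjI)
    show "count_list (take j R) North = i"
      using R_j(2) unfolding height_def .
  qed (use North j len in simp_all)
  moreover have "R \<in> paths_between m r P Q"
    using R between unfolding paths_between_def never_above_def height_def by simp
  ultimately show "j \<in> North_set m r P Q i"
    unfolding North_set_def by blast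
qed

text \<open>The index assigned to \<open>x \<in> I\<close> is the least one possible when the elements of \<open>I\<close> are
  matched greedily from left to right.\<close>

lemma transversal_indep_iff:
  fixes p q :: "nat \<Rightarrow> nat"
  assumes p: "\<And>s t. s \<le> t \<Longrightarrow> p s \<le> p t" and q: "\<And>s t. s \<le> t \<Longrightarrow> q s \<le> q t"
    and p_le_q: "\<And>k. p k \<le> q k" and q_le_r: "\<And>k. q k \<le> r"
    and A: "\<And>i j. j \<in> A i \<longleftrightarrow> 1 \<le> j \<and> j \<le> n \<and> p (j - 1) < i \<and> i \<le> q j"
  shows "indep (transversal_matroid {1..n} r A) I \<longleftrightarrow>
    I \<subseteq> {1..n} \<and> (\<forall>s t. s \<le> t \<longrightarrow> p s + card (I \<inter> {s<..t}) \<le> q t)"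
proof
  assume "indep (transversal_matroid {1..n} r A) I"
  then obtain f where I: "I \<subseteq> {1..n}" and f: "inj_on f I" "\<And>x. x \<in> I \<Longrightarrow> x \<in> A (f x)"
    unfolding transversal_matroid_def by auto
  have "p s + card (I \<inter> {s<..t}) \<le> q t" if "s \<le> t" for s t
  proof -
    \<comment> \<open>Elements of \<open>(s,t]\<close> can only receive indices from
      \<open>p s + 1\<close> to \<open>q t\<close>.\<close>
    have "f ` (I \<inter> {s<..t}) \<subseteq> {p s<..q t}"
    proof
      fix y
      assume "y \<in> f ` (I \<inter> {s<..t})"
      then obtain x where "y = f x" "x \<in> I" "s \<le> x - 1" "x \<le> t"
        by auto
      then show "y \<in> {p s<..q t}"
        using f(2)[of x] p[of s "x - 1"] q[of x t] unfolding A by simp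
    qed
    then have "card (f ` (I \<inter> {s<..t})) \<le> card {p s<..q t}"
      by (intro card_mono) auto
    moreover have "card (f ` (I \<inter> {s<..t})) = card (I \<inter> {s<..t})"
      using f(1) by (intro card_image) (auto intro: inj_on_subset)
    ultimately show ?thesis
      using p_le_q[of s] q[OF that] by simp
  qed
  then show "I \<subseteq> {1..n} \<and> (\<forall>s t. s \<le> t \<longrightarrow> p s + card (I \<inter> {s<..t}) \<le> q t)"
    using I by blast
next
  assume "I \<subseteq> {1..n} \<and> (\<forall>s t. s \<le> t \<longrightarrow> p s + card (I \<inter> {s<..t}) \<le> q t)"
  then have I: "I \<subseteq> {1..n}" and le: "\<And>s t. s \<le> t \<Longrightarrow> p s + card (I \<inter> {s<..t}) \<le> q t"
    by auto
  \<comment> \<open>Closed form, on \<open>I\<close>, of the greedy rule by which the next index is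
    the larger of \<open>p (x - 1) + 1\<close> and the previous index plus one.\<close>
  define f where "f = (\<lambda>x. Max ((\<lambda>s. p s + card (I \<inter> {s<..x})) ` {..<x}))"
  have f_ge: "p s + card (I \<inter> {s<..x}) \<le> f x" if "s < x" for s x
    unfolding f_def using that by (intro Max_ge) auto
  have f_eq: "\<exists>s<x. f x = p s + card (I \<inter> {s<..x})" if "0 < x" for x
  proof -
    have "f x \<in> (\<lambda>s. p s + card (I \<inter> {s<..x})) ` {..<x}"
      unfolding f_def using that by (intro Max_in) auto
    then show ?thesis
      by auto
  qed
  have less: "f x < f y" if "x \<in> I" "y \<in> I" "x < y" for x y
  proof -
    have "0 < x"
      using I that(1) by auto
    then obtain s where s: "s < x" "f x = p s + card (I \<inter> {s<..x})"
      using f_eq by blast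
    have "card (insert y (I \<inter> {s<..x})) \<le> card (I \<inter> {s<..y})"
      using that s(1) by (intro card_mono) auto
    then show ?thesis
      using f_ge[of s y] s that(3) by simp
  qed
  then have "inj_on f I"
    by (intro linorder_inj_onI) (auto simp: less_imp_neq)
  moreover have "f x \<in> {1..r} \<and> x \<in> A (f x)" if "x \<in> I" for x
  proof -
    have x: "1 \<le> x" "x \<le> n"
      using I that by auto
    \<comment> \<open>Taking \<open>s = x - 1\<close> gives the lower bound on \<open>f x\<close>;
      the upper bound is \<open>le\<close> at the maximising \<open>s\<close>.\<close>
    have "I \<inter> {x - 1<..x} = {x}"
      using that x by auto
    then have "p (x - 1) < f x"
      using f_ge[of "x - 1" x] x by simp
    moreover have "f x \<le> q x"
      using f_eq[of x] le[of _ x] x by (metis One_nat_def Suc_le_lessD less_imp_le)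
    ultimately show ?thesis
      using x q_le_r[of x] by (auto simp: A)
  qed
  ultimately show "indep (transversal_matroid {1..n} r A) I"
    using I unfolding transversal_matroid_def by auto
qed

lemma lattice_path_bounded_paths:
  assumes P: "P \<in> lattice_paths m r" and Q: "Q \<in> lattice_paths m r" and PQ: "never_above P Q"
  shows "bounded_paths (m + r) r (height P) (height Q) (lattice_path_matroid m r P Q)"
proof
  show le: "height P k \<le> height Q k" for k
    using PQ unfolding never_above_def height_def by blast
  show "is_matroid (lattice_path_matroid m r P Q)"
    unfolding lattice_path_matroid_def by (rule is_matroid_transversal_matroid) simp
  show "ground (lattice_path_matroid m r P Q) = {1..m + r}"
    by (simp add: lattice_path_matroid_def transversal_matroid_def)
  have "height Q k \<le> r" for k
    using unit_steps_mono[OF unit_steps_height, of k "max k (m + r)" Q]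
      lattice_path_height[OF Q, of "max k (m + r)"] by simp
  note transversal_indep_iff[OF unit_steps_mono[OF unit_steps_height]
      unit_steps_mono[OF unit_steps_height] le this North_set_iff[OF P Q PQ]]
  then show "indep (lattice_path_matroid m r P Q) I \<longleftrightarrow> I \<subseteq> {1..m + r} \<and>
      (\<forall>s t. s \<le> t \<longrightarrow> height P s + card (I \<inter> {s<..t}) \<le> height Q t)" for I
    unfolding lattice_path_matroid_def .
qed (simp_all add: unit_steps_height height_0 lattice_path_height[OF P] lattice_path_height[OF Q])

lemma small_ground_proper_subset:
  "X \<subseteq> {1..n} \<Longrightarrow> X \<noteq> {1..n} \<Longrightarrow> n < (2 :: nat) \<Longrightarrow> X = {}"
  by (cases "n = 0") (auto simp: less_2_cases_iff)

theorem theorem5p7: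
  fixes m r h k :: nat
    and P Q :: "step list"
    and M :: "nat matroid"
    and F G :: "nat \<Rightarrow> nat set"
  assumes "P \<in> lattice_paths m r" and "Q \<in> lattice_paths m r" and "never_above P Q"
    and "M = lattice_path_matroid m r P Q"
    and "connected_matroid M"
    and "strict_mono_on {1..h} F"
    and "F ` {1..h} = {X. fundamental_flat M X \<and> initial_segment X}"
    and "strict_mono_on {1..k} G"
    and "G ` {1..k} = {X. fundamental_flat M X \<and> final_segment (m + r) X}"
  shows "{X. connected_flat M X \<and> nontrivial M X \<and> X \<noteq> ground M}
           = F ` {1..h} \<union> G ` {1..k}
             \<union> {F i \<inter> G j |i j. i \<in> {1..h} \<and> j \<in> {1..k} \<and>
                                   m < nullity M (F i) + nullity M (G j)}
         \<and> (\<forall>i\<in>{1..h}. \<forall>j\<in>{1..k}.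
               connected_flat M (F i \<inter> G j) \<and> nontrivial M (F i \<inter> G j)
               \<longrightarrow> int (rk M (F i \<inter> G j)) = int (rk M (F i)) + int (rk M (G j)) - int r)"
proof (cases "m + r < 2")
  case True
  interpret bounded_paths "m + r" r "height P" "height Q" M
    unfolding assms(4) by (rule lattice_path_bounded_paths[OF assms(1-3)])
  \<comment> \<open>With at most one element there is no fundamental flat, and a nontrivial set is
    the whole ground set. Both sides are empty and the rank claim is vacuous.\<close>
  have "card X \<le> 1" if "flat M X" for X
    using that card_mono[of "{1..m + r}" X] True unfolding flat_def ground by simp
  then have "\<not> fundamental_flat M X" for X
    unfolding fundamental_flat_def connected_flat_def by (meson not_le)
  then have "F ` {1..h} = {}" "G ` {1..k} = {}"
    unfolding assms(7,9) by simp_all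
  moreover have "X = ground M" if "nontrivial M X" for X
    using that small_ground_proper_subset[of X "m + r"] True indep_empty[OF matroid]
    unfolding nontrivial_def ground by metis
  ultimately show ?thesis
    by auto
next
  case False
  interpret connected_paths "m + r" r "height P" "height Q" M
    using lattice_path_bounded_paths[OF assms(1-3)] assms(5) False
    unfolding assms(4) connected_paths_def connected_paths_axioms_def by simp
  show ?thesis
    using connected_flats[OF refl assms(7,9)] by (intro conjI ballI impI) simp_all
qed

end
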